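(* Let $C_n$ be the cycle graph on $[n]$. The v-number of the binomial edge ideal $J_{C_n}$ satisfies the following: (i) if $n\equiv0\pmod 3$, then $\mathrm{v}(J_{C_n})=\frac{2n}{3}$; (ii) if $n\equiv1$ or $2\pmod3$, then $\mathrm{v}(J_{C_n})$ is either $\left\lceil\frac{2n}{3}\right\rceil$ or $\left\lceil\frac{2n}{3}\right\rceil-1$.
   Context: $C_n$ is the graph with vertex set $[n]=\{1,\dots,n\}$ and edges $\{i,i+1\}$ for $i\in[n]$, with the convention $n+1=1$. The binomial edge ideal of a simple graph $G$ on $[n]$ is $J_G=(x_iy_j-x_jy_i : \{i,j\}\in E(G),\ i<j)\subset R=\mathbb{C}[x_1,\dots,x_n,y_1,\dots,y_n]$, where $R$ has the standard grading. For a homogeneous ideal $I\subset R$, the v-number is $\mathrm{v}(I)=\min\{d\ge0 : \exists f\in R \text{ homogeneous of degree } d \text{ and } \mathfrak{p}\in\mathrm{Ass}(I) \text{ with } (I:f)=\mathfrak{p}\}$.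
   Formalization: The formal theorem assumes n ≥ 4: for n = 3 the claim fails, since C_3 = K_3 has a prime binomial edge ideal, so its v-number is 0 rather than 2n/3 = 2; for n < 3, C_n is not a cycle. *)

theory Defs
  imports Complex_Main "HOL-Library.Poly_Mapping" "HOL-Algebra.Ideal"
begin

datatype var = X nat | Y nat

type_synonym mpoly = "(var \<Rightarrow>\<^sub>0 nat) \<Rightarrow>\<^sub>0 complex"

definition indet :: "var \<Rightarrow> mpoly" where
  "indet v = Poly_Mapping.single (Poly_Mapping.single v 1) 1"

definition vars :: "nat \<Rightarrow> var set" where
  "vars n = X ` {1..n} \<union> Y ` {1..n}"

definition poly_ring :: "nat \<Rightarrow> mpoly ring" where
  "poly_ring n =
    \<lparr>carrier = {p. \<forall>m\<in>Poly_Mapping.keys p. Poly_Mapping.keys m \<subseteq> vars n},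
     mult = (*), one = 1, zero = 0, add = (+)\<rparr>"

definition mon_degree :: "(var \<Rightarrow>\<^sub>0 nat) \<Rightarrow> nat" where
  "mon_degree m = (\<Sum>v\<in>Poly_Mapping.keys m. Poly_Mapping.lookup m v)"

text \<open>As usual, the zero polynomial is homogeneous of every degree.\<close>

definition homogeneous :: "nat \<Rightarrow> mpoly \<Rightarrow> bool" where
  "homogeneous d f \<longleftrightarrow> (\<forall>m\<in>Poly_Mapping.keys f. mon_degree m = d)"

definition colon :: "('a, 'b) ring_scheme \<Rightarrow> 'a set \<Rightarrow> 'a \<Rightarrow> 'a set" where
  "colon R I f = {g \<in> carrier R. g \<otimes>\<^bsub>R\<^esub> f \<in> I}"

text \<open>
  The associated primes of \<open>I\<close> are those of the module \<open>R/I\<close>: the prime ideals that are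
  annihilators of residue classes \<open>f + I\<close>, and such an annihilator is \<open>(I : f)\<close>.
\<close>

definition Ass :: "('a, 'b) ring_scheme \<Rightarrow> 'a set \<Rightarrow> 'a set set" where
  "Ass R I = {P. primeideal P R \<and> (\<exists>f\<in>carrier R. P = colon R I f)}"

definition v_number :: "nat \<Rightarrow> mpoly set \<Rightarrow> nat" where
  "v_number n I =
    (LEAST d. \<exists>f\<in>carrier (poly_ring n). homogeneous d f \<and>
       (\<exists>P\<in>Ass (poly_ring n) I. colon (poly_ring n) I f = P))"

definition binomial_edge_ideal :: "nat \<Rightarrow> nat set set \<Rightarrow> mpoly set" where
  "binomial_edge_ideal n E =
    Idl\<^bsub>poly_ring n\<^esub>
      {indet (X i) * indet (Y j) - indet (X j) * indet (Y i) | i j. {i, j} \<in> E \<and> i < j}"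

definition cycle_edges :: "nat \<Rightarrow> nat set set" where
  "cycle_edges n = {{i, if i = n then 1 else i + 1} | i. i \<in> {1..n}}"

end

theory Submission
  imports Defs
begin

text \<open>
  For a set \<open>T\<close> of vertices let \<open>P\<^sub>T\<close> be the kernel of the substitution that kills \<open>x\<^sub>i, y\<^sub>i\<close> for
  \<open>i \<in> T\<close> and makes the vectors \<open>(x\<^sub>i, y\<^sub>i)\<close> parallel along each component of \<open>G - T\<close>. Since \<open>J\<^sub>G\<close> is
  spanned by differences of monomials, \<open>J\<^sub>G\<close> is the intersection of the primes \<open>P\<^sub>T\<close>. Hence if
  \<open>(J : f)\<close> is prime, it equals some \<open>P\<^sub>S\<close> with \<open>f \<notin> P\<^sub>S\<close>.

  Lower bound: let \<open>a\<close> be a multidegree in which \<open>f\<close> does not vanish modulo \<open>P\<^sub>S\<close>. As \<open>P\<^sub>S\<close> multiplies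
  \<open>f\<close> into \<open>J\<close>, for the cycle \<open>a\<close> is positive outside \<open>S\<close> if \<open>S \<noteq> {}\<close>, has at most two zeros if
  \<open>S = {}\<close>, and for \<open>|S| \<ge> 3\<close> is at least 2 on an arc consisting of a single vertex. So the degree
  \<open>d\<close> is at least \<open>n - 2\<close>, or it is at least both \<open>n - |S|\<close> and \<open>2|S|\<close>, whence \<open>3d \<ge> 2n\<close>.

  Upper bound: for pairwise non-adjacent \<open>S\<close> with \<open>|S| \<ge> 2\<close>, the product of the minors on the pairs
  \<open>s - 1, s + 1\<close> for \<open>s \<in> S\<close> and of the \<open>x\<^sub>i\<close> for \<open>i\<close> at distance at least 2 from \<open>S\<close> has colon ideal \<open>P\<^sub>S\<close>; take
  \<open>S\<close> with every third vertex.
\<close>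

abbreviation (input) "lookup \<equiv> Poly_Mapping.lookup"
abbreviation (input) "keys \<equiv> Poly_Mapping.keys"
abbreviation (input) "single \<equiv> Poly_Mapping.single"

type_synonym mono = "var \<Rightarrow>\<^sub>0 nat"
type_synonym target = "(nat \<Rightarrow>\<^sub>0 nat) \<Rightarrow>\<^sub>0 complex"

subsection \<open>Polynomials as sums of terms\<close>

lemma sum_single_keys:
  fixes f :: "'a \<Rightarrow>\<^sub>0 'b::comm_monoid_add"
  assumes "finite A" "keys f \<subseteq> A"
  shows "(\<Sum>m\<in>A. single m (lookup f m)) = f"
proof (rule poly_mapping_eqI)
  fix k
  have "lookup (\<Sum>m\<in>A. single m (lookup f m)) k = (\<Sum>m\<in>A. lookup f m when m = k)"
    by (simp add: lookup_sum lookup_single)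
  also have "\<dots> = (\<Sum>m\<in>A. if k = m then lookup f k else 0)"
    by (intro sum.cong) (auto simp: when_def)
  also have "\<dots> = lookup f k"
    using assms by (auto simp: in_keys_iff)
  finally show "lookup (\<Sum>m\<in>A. single m (lookup f m)) k = lookup f k" .
qed

definition restr :: "('a \<Rightarrow> bool) \<Rightarrow> ('a \<Rightarrow>\<^sub>0 'b::comm_monoid_add) \<Rightarrow> ('a \<Rightarrow>\<^sub>0 'b)" where
  "restr Q f = (\<Sum>m\<in>{m \<in> keys f. Q m}. single m (lookup f m))"

lemma lookup_restr: "lookup (restr Q f) k = (if Q k then lookup f k else 0)"
proof -
  have "lookup (restr Q f) k = (\<Sum>m\<in>{m \<in> keys f. Q m}. if k = m then lookup f k else 0)"
    unfolding restr_def lookup_sum by (intro sum.cong) (auto simp: lookup_single when_def)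
  then show ?thesis
    by (auto simp: in_keys_iff)
qed

lemma keys_restr: "keys (restr Q f) = {m \<in> keys f. Q m}"
  by (auto simp: in_keys_iff lookup_restr split: if_splits)

subsection \<open>The parametrisations of the components\<close>

text \<open>The grading by vertices, in which \<open>X i\<close> and \<open>Y i\<close> have the
  same degree; the substitutions below respect it.\<close>

definition mdeg :: "mono \<Rightarrow> nat \<Rightarrow> nat" where
  "mdeg m i = lookup m (X i) + lookup m (Y i)"

definition avoids :: "nat set \<Rightarrow> mono \<Rightarrow> bool" where
  "avoids T m \<longleftrightarrow> (\<forall>i\<in>T. mdeg m i = 0)"

text \<open>Exponent of the image of the monomial \<open>m\<close> under the substitution
  \<open>phi\<close>. Even and odd positions keep two families of indeterminates apart in one index
  type.\<close>

definition theta :: "nat \<Rightarrow> (nat \<Rightarrow> nat) \<Rightarrow> mono \<Rightarrow> (nat \<Rightarrow>\<^sub>0 nat)" where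
  "theta n h m = (\<Sum>i\<in>{1..n}. single (2 * i) (mdeg m i) + single (2 * h i + 1) (lookup m (Y i)))"

text \<open>
  The substitution sending \<open>x\<^sub>i\<close> to \<open>t\<^sub>i\<close> and \<open>y\<^sub>i\<close> to \<open>t\<^sub>i b\<^bsub>h i\<^esub>\<close> for \<open>i\<close> outside \<open>T\<close>, and to \<open>0\<close>
  for \<open>i\<close> in \<open>T\<close>. In the target ring the even indeterminates are the \<open>t\<^sub>i\<close>, the odd ones the \<open>b\<^sub>j\<close>.
\<close>

definition phi :: "nat \<Rightarrow> nat set \<Rightarrow> (nat \<Rightarrow> nat) \<Rightarrow> mpoly \<Rightarrow> target" where
  "phi n T h f = (\<Sum>m\<in>{m \<in> keys f. avoids T m}. single (theta n h m) (lookup f m))"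

lemma mdeg_add: "mdeg (m + m') i = mdeg m i + mdeg m' i"
  by (simp add: mdeg_def lookup_add)

lemma mdeg_single_X [simp]: "mdeg (single (X i) c) j = (if i = j then c else 0)"
  and mdeg_single_Y [simp]: "mdeg (single (Y i) c) j = (if i = j then c else 0)"
  by (auto simp: mdeg_def lookup_single when_def)

lemma mdeg_zero [simp]: "mdeg 0 i = 0"
  by (simp add: mdeg_def)

lemma avoids_add: "avoids T (m + m') \<longleftrightarrow> avoids T m \<and> avoids T m'"
  by (auto simp: avoids_def mdeg_add)

lemma theta_add: "theta n h (m + m') = theta n h m + theta n h m'"
  unfolding theta_def sum.distrib[symmetric]
  by (intro sum.cong) (simp_all add: mdeg_add lookup_add single_add ac_simps)

lemma lookup_theta_even: "lookup (theta n h m) (2 * i) = (if i \<in> {1..n} then mdeg m i else 0)"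
proof -
  have "lookup (theta n h m) (2 * i) = (\<Sum>j\<in>{1..n}. if i = j then mdeg m i else 0)"
    unfolding theta_def lookup_sum
    by (intro sum.cong) (auto simp: lookup_add lookup_single when_def, presburger)
  then show ?thesis by simp
qed

lemma lookup_theta_odd:
  "lookup (theta n h m) (2 * l + 1) = (\<Sum>i\<in>{i \<in> {1..n}. h i = l}. lookup m (Y i))"
proof -
  have "lookup (theta n h m) (2 * l + 1) = (\<Sum>i\<in>{1..n}. if h i = l then lookup m (Y i) else 0)"
    unfolding theta_def lookup_sum
    by (intro sum.cong) (auto simp: lookup_add lookup_single when_def, presburger)
  then show ?thesis by (simp only: sum.inter_filter[OF finite_atLeastAtMost])
qed

text \<open>Even positions read off the multidegree, odd positions the total
  \<open>Y\<close>-exponent on each class of the labelling, and every position is one or the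
  other.\<close>

lemma theta_eq_iff:
  "theta n h m = theta n h' m' \<longleftrightarrow>
    (\<forall>i\<in>{1..n}. mdeg m i = mdeg m' i) \<and>
    (\<forall>l. (\<Sum>i\<in>{i \<in> {1..n}. h i = l}. lookup m (Y i)) = (\<Sum>i\<in>{i \<in> {1..n}. h' i = l}. lookup m' (Y i)))"
  (is "?L \<longleftrightarrow> ?R")
proof
  assume ?L
  then have "lookup (theta n h m) k = lookup (theta n h' m') k" for k by simp
  from this[of "2 * i" for i] this[of "2 * l + 1" for l] show ?R
    unfolding lookup_theta_odd unfolding lookup_theta_even by (metis (lifting))
next
  assume R: ?R
  show ?L
  proof (rule poly_mapping_eqI)
    fix k
    show "lookup (theta n h m) k = lookup (theta n h' m') k"
    proof (cases "even k")
      case True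
      then obtain i where "k = 2 * i" by (elim evenE)
      then show ?thesis using R by (simp add: lookup_theta_even)
    next
      case False
      then obtain i where "k = 2 * i + 1" by (elim oddE)
      then show ?thesis using R by (simp only: lookup_theta_odd)
    qed
  qed
qed

lemma mdeg_eq_of_theta_eq: "theta n h m = theta n h' m' \<Longrightarrow> i \<in> {1..n} \<Longrightarrow> mdeg m i = mdeg m' i"
  unfolding theta_eq_iff by blast

lemma phi_eq_sum:
  assumes "finite A" "keys f \<subseteq> A"
  shows "phi n T h f = (\<Sum>m\<in>A. if avoids T m then single (theta n h m) (lookup f m) else 0)"
proof -
  have "phi n T h f = (\<Sum>m\<in>keys f. if avoids T m then single (theta n h m) (lookup f m) else 0)"
    by (simp add: phi_def sum.inter_filter)
  also have "\<dots> = (\<Sum>m\<in>A. if avoids T m then single (theta n h m) (lookup f m) else 0)"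
    using assms by (intro sum.mono_neutral_left) (auto simp: in_keys_iff)
  finally show ?thesis .
qed

lemma lookup_phi:
  "lookup (phi n T h f) w = (\<Sum>m\<in>{m \<in> keys f. avoids T m \<and> theta n h m = w}. lookup f m)"
proof -
  have "lookup (phi n T h f) w = (\<Sum>m\<in>{m \<in> keys f. avoids T m}. if theta n h m = w then lookup f m else 0)"
    unfolding phi_def lookup_sum by (intro sum.cong) (auto simp: lookup_single when_def)
  also have "\<dots> = (\<Sum>m\<in>{m \<in> {m \<in> keys f. avoids T m}. theta n h m = w}. lookup f m)"
    by (rule sum.inter_filter[symmetric]) simp
  also have "{m \<in> {m \<in> keys f. avoids T m}. theta n h m = w} = {m \<in> keys f. avoids T m \<and> theta n h m = w}"
    by auto
  finally show ?thesis .
qed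

lemma phi_zero [simp]: "phi n T h 0 = 0"
  by (simp add: phi_def)

lemma phi_add: "phi n T h (f + g) = phi n T h f + phi n T h g"
proof -
  have A: "finite (keys f \<union> keys g)" "keys (f + g) \<subseteq> keys f \<union> keys g"
    "keys f \<subseteq> keys f \<union> keys g" "keys g \<subseteq> keys f \<union> keys g"
    using Poly_Mapping.keys_add[of f g] by auto
  show ?thesis
    unfolding phi_eq_sum[OF A(1) A(2)] phi_eq_sum[OF A(1) A(3)] phi_eq_sum[OF A(1) A(4)]
      sum.distrib[symmetric]
    by (intro sum.cong) (simp_all add: lookup_add single_add)
qed

lemma phi_sum: "phi n T h (sum F A) = (\<Sum>a\<in>A. phi n T h (F a))"
  by (induction A rule: infinite_finite_induct) (simp_all add: phi_add)

lemma phi_uminus: "phi n T h (- f) = - phi n T h f"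
  using phi_add[of n T h f "- f"] by (simp add: eq_neg_iff_add_eq_0 add.commute)

lemma phi_diff: "phi n T h (f - g) = phi n T h f - phi n T h g"
  using phi_add[of n T h f "- g"] by (simp add: phi_uminus)

lemma phi_single: "phi n T h (single m c) = (if avoids T m then single (theta n h m) c else 0)"
  by (subst phi_eq_sum[of "{m}"]) auto

lemma phi_mult: "phi n T h (f * g) = phi n T h f * phi n T h g"
proof -
  have single_case: "phi n T h (single m c * single m' c') = phi n T h (single m c) * phi n T h (single m' c')"
    for m m' c c'
    by (simp add: mult_single phi_single avoids_add theta_add)
  have "f * g = (\<Sum>m\<in>keys f. single m (lookup f m)) * (\<Sum>m\<in>keys g. single m (lookup g m))"
    by (simp add: sum_single_keys)
  also have "phi n T h \<dots> =
      (\<Sum>m\<in>keys f. phi n T h (single m (lookup f m))) * (\<Sum>m\<in>keys g. phi n T h (single m (lookup g m)))"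
    by (simp add: sum_product phi_sum single_case)
  also have "\<dots> = phi n T h f * phi n T h g"
    unfolding phi_sum[symmetric] by (simp add: sum_single_keys)
  finally show ?thesis .
qed

lemma phi_one [simp]: "phi n T h 1 = 1"
  using phi_single[of n T h 0 1] by (simp add: avoids_def theta_def)

lemma phi_prod: "phi n T h (prod F A) = (\<Prod>a\<in>A. phi n T h (F a))"
  by (induction A rule: infinite_finite_induct) (simp_all add: phi_mult)

lemma theta_single_X: "i \<in> {1..n} \<Longrightarrow> theta n h (single (X i) 1) = single (2 * i) 1"
  and theta_single_Y:
    "i \<in> {1..n} \<Longrightarrow> theta n h (single (Y i) 1) = single (2 * i) 1 + single (2 * h i + 1) 1"
proof -
  assume i: "i \<in> {1..n}"
  have "theta n h (single (X i) 1) = (\<Sum>j\<in>{1..n}. if i = j then single (2 * i) 1 else 0)"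
    unfolding theta_def by (intro sum.cong) (auto simp: lookup_single when_def)
  then show "theta n h (single (X i) 1) = single (2 * i) 1" using i by simp
  have "theta n h (single (Y i) 1) =
      (\<Sum>j\<in>{1..n}. if i = j then single (2 * i) 1 + single (2 * h i + 1) 1 else 0)"
    unfolding theta_def by (intro sum.cong) (auto simp: lookup_single when_def)
  then show "theta n h (single (Y i) 1) = single (2 * i) 1 + single (2 * h i + 1) 1" using i by simp
qed

lemma phi_X: "i \<in> {1..n} \<Longrightarrow> phi n T h (indet (X i)) = (if i \<in> T then 0 else single (single (2 * i) 1) 1)"
  and phi_Y: "i \<in> {1..n} \<Longrightarrow> phi n T h (indet (Y i)) =
    (if i \<in> T then 0 else single (single (2 * i) 1 + single (2 * h i + 1) 1) 1)"
  using theta_single_X[of i n h] theta_single_Y[of i n h]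
  by (auto simp: indet_def phi_single avoids_def)

definition minor :: "nat \<Rightarrow> nat \<Rightarrow> mpoly" where
  "minor u v = indet (X u) * indet (Y v) - indet (X v) * indet (Y u)"

text \<open>Outside \<open>T\<close> the image is t_u t_v (b_{h v} - b_{h u}) in the notation
  above.\<close>

lemma phi_minor_eq_0:
  assumes "u \<in> {1..n}" "v \<in> {1..n}"
  shows "phi n T h (minor u v) = 0 \<longleftrightarrow> u \<in> T \<or> v \<in> T \<or> h u = h v"
proof -
  have inj: "single (2 * h v + 1) (1::nat) = single (2 * h u + 1) 1 \<longleftrightarrow> h u = h v"
    by (metis add_right_cancel keys_single mult_left_cancel pos2 the_elem_eq zero_neq_one
        less_numeral_extra(3))
  have inj2: "single k (1::complex) = single k' 1 \<longleftrightarrow> k = k'" for k k' :: "nat \<Rightarrow>\<^sub>0 nat"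
    by (metis keys_single the_elem_eq zero_neq_one)
  let ?a = "single (2 * u) (1::nat) + single (2 * v) 1"
  have "phi n T h (minor u v) =
     (if u \<in> T \<or> v \<in> T then 0
      else single (?a + single (2 * h v + 1) 1) 1 - single (?a + single (2 * h u + 1) 1) 1)"
    using assms by (auto simp: minor_def phi_diff phi_mult phi_X phi_Y mult_single ac_simps)
  then show ?thesis using inj by (simp add: inj2)
qed

text \<open>
  The hypothesis says that \<open>phi n T' h'\<close> factors through \<open>phi n T h\<close> on the terms of \<open>g\<close>.
\<close>

lemma phi_eq_0_mono:
  assumes "phi n T h g = 0"
    and "\<And>m. m \<in> keys g \<Longrightarrow> avoids T' m \<Longrightarrow> avoids T m"
    and "\<And>m m'. \<lbrakk>m \<in> keys g; m' \<in> keys g; avoids T' m; avoids T m'; theta n h m = theta n h m'\<rbrakk>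
      \<Longrightarrow> avoids T' m' \<and> theta n h' m = theta n h' m'"
  shows "phi n T' h' g = 0"
proof (rule poly_mapping_eqI)
  fix w
  let ?A = "{m \<in> keys g. avoids T' m \<and> theta n h' m = w}"
  \<comment> \<open>Group the terms by \<open>theta n h\<close>: every group is a whole fibre, so
    its coefficients add up to one coefficient of \<open>phi n T h g\<close>.\<close>
  have "lookup (phi n T' h' g) w = (\<Sum>k\<in>theta n h ` ?A. \<Sum>m\<in>{m \<in> ?A. theta n h m = k}. lookup g m)"
    unfolding lookup_phi by (rule sum.image_gen) simp
  also have "\<dots> = 0"
  proof (rule sum.neutral, rule ballI)
    fix k assume "k \<in> theta n h ` ?A"
    then obtain m0 where m0: "m0 \<in> ?A" "theta n h m0 = k" by auto
    have "{m \<in> ?A. theta n h m = k} = {m \<in> keys g. avoids T m \<and> theta n h m = k}"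
    proof (intro equalityI subsetI)
      fix m assume "m \<in> {m \<in> ?A. theta n h m = k}"
      then show "m \<in> {m \<in> keys g. avoids T m \<and> theta n h m = k}" using assms(2) by simp
    next
      fix m assume "m \<in> {m \<in> keys g. avoids T m \<and> theta n h m = k}"
      then show "m \<in> {m \<in> ?A. theta n h m = k}" using assms(3)[of m0 m] m0 by simp
    qed
    then show "(\<Sum>m\<in>{m \<in> ?A. theta n h m = k}. lookup g m) = 0"
      using lookup_phi[of n T h g k] assms(1) by simp
  qed
  finally show "lookup (phi n T' h' g) w = lookup 0 w" by simp
qed

text \<open>On the vertices that occur in \<open>m\<close>, each class of \<open>h'\<close> is a
  union of classes of \<open>h\<close>, so its \<open>Y\<close>-total is a sum of known totals.
  Vertices of degree 0 contribute nothing.\<close>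

lemma theta_mono:
  assumes "theta n h m = theta n h m'"
    and "\<And>u v. \<lbrakk>u \<in> {1..n}; v \<in> {1..n}; mdeg m u > 0; mdeg m v > 0; h u = h v\<rbrakk> \<Longrightarrow> h' u = h' v"
  shows "theta n h' m = theta n h' m'"
proof -
  have deg: "mdeg m i = mdeg m' i" if "i \<in> {1..n}" for i
    using assms(1) that unfolding theta_eq_iff by blast
  let ?P = "{i \<in> {1..n}. mdeg m i > 0}"
  have restrict: "(\<Sum>i\<in>{i \<in> {1..n}. k i = l}. lookup q (Y i)) = (\<Sum>i\<in>{i \<in> ?P. k i = l}. lookup q (Y i))"
    if "q = m \<or> q = m'" for q l and k :: "nat \<Rightarrow> nat"
  proof (rule sum.mono_neutral_right)
    show "\<forall>i\<in>{i \<in> {1..n}. k i = l} - {i \<in> ?P. k i = l}. lookup q (Y i) = 0"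
    proof
      fix i assume "i \<in> {i \<in> {1..n}. k i = l} - {i \<in> ?P. k i = l}"
      then have "mdeg q i = 0" using that deg[of i] by auto
      then show "lookup q (Y i) = 0" by (simp add: mdeg_def)
    qed
  qed auto
  have "(\<Sum>i\<in>{i \<in> ?P. h' i = l}. lookup m (Y i)) = (\<Sum>i\<in>{i \<in> ?P. h' i = l}. lookup m' (Y i))" for l
  proof -
    let ?A = "{i \<in> ?P. h' i = l}"
    have eq: "{i \<in> ?A. h i = k} = {i \<in> ?P. h i = k}" if "k \<in> h ` ?A" for k
    proof -
      from that obtain j where "j \<in> ?A" "h j = k" by auto
      then show ?thesis using assms(2)[of _ j] by auto
    qed
    have "(\<Sum>i\<in>{i \<in> ?P. h i = k}. lookup m (Y i)) = (\<Sum>i\<in>{i \<in> ?P. h i = k}. lookup m' (Y i))" for k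
      using assms(1) restrict[of m h k] restrict[of m' h k] unfolding theta_eq_iff by auto
    then have eq': "(\<Sum>k\<in>h ` ?A. \<Sum>i\<in>{i \<in> ?A. h i = k}. lookup m (Y i)) =
        (\<Sum>k\<in>h ` ?A. \<Sum>i\<in>{i \<in> ?A. h i = k}. lookup m' (Y i))"
      by (intro sum.cong[OF refl, of "h ` ?A"]) (simp only: eq)
    have gen: "(\<Sum>i\<in>?A. lookup q (Y i)) = (\<Sum>k\<in>h ` ?A. \<Sum>i\<in>{i \<in> ?A. h i = k}. lookup q (Y i))" for q
      by (rule sum.image_gen) simp
    show ?thesis unfolding gen by (rule eq')
  qed
  then show ?thesis
    unfolding theta_eq_iff restrict[OF disjI1[OF refl]] restrict[OF disjI2[OF refl]]
    using deg by blast
qed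

subsection \<open>The polynomial ring and the kernels of the parametrisations\<close>

lemma poly_ring_simps [simp]:
  "mult (poly_ring n) = (*)" "one (poly_ring n) = 1" "zero (poly_ring n) = 0" "add (poly_ring n) = (+)"
  by (simp_all add: poly_ring_def)

lemma carrier_iff: "f \<in> carrier (poly_ring n) \<longleftrightarrow> (\<forall>m\<in>keys f. keys m \<subseteq> vars n)"
  by (simp add: poly_ring_def)

lemma carrier_zero [simp]: "0 \<in> carrier (poly_ring n)"
  and carrier_one [simp]: "1 \<in> carrier (poly_ring n)"
  by (auto simp: carrier_iff)

lemma carrier_add: "f \<in> carrier (poly_ring n) \<Longrightarrow> g \<in> carrier (poly_ring n) \<Longrightarrow> f + g \<in> carrier (poly_ring n)"
  using Poly_Mapping.keys_add[of f g] by (auto simp: carrier_iff)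

lemma carrier_uminus: "f \<in> carrier (poly_ring n) \<Longrightarrow> - f \<in> carrier (poly_ring n)"
  by (auto simp: carrier_iff in_keys_iff)

lemma carrier_diff: "f \<in> carrier (poly_ring n) \<Longrightarrow> g \<in> carrier (poly_ring n) \<Longrightarrow> f - g \<in> carrier (poly_ring n)"
  using carrier_add[of f n "- g"] by (simp add: carrier_uminus)

lemma carrier_mult:
  assumes "f \<in> carrier (poly_ring n)" "g \<in> carrier (poly_ring n)"
  shows "f * g \<in> carrier (poly_ring n)"
  unfolding carrier_iff
proof
  fix m assume "m \<in> keys (f * g)"
  then obtain a b where "m = a + b" "a \<in> keys f" "b \<in> keys g"
    using Poly_Mapping.keys_mult[of f g] by auto
  then show "keys m \<subseteq> vars n"
    using assms Poly_Mapping.keys_add[of a b] by (fastforce simp: carrier_iff)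
qed

lemma carrier_prod:
  "(\<And>a. a \<in> A \<Longrightarrow> F a \<in> carrier (poly_ring n)) \<Longrightarrow> prod F A \<in> carrier (poly_ring n)"
  by (induction A rule: infinite_finite_induct) (simp_all add: carrier_mult)

lemma carrier_single: "keys m \<subseteq> vars n \<Longrightarrow> single m c \<in> carrier (poly_ring n)"
  by (simp add: carrier_iff)

lemma X_in_vars [simp]: "X i \<in> vars n \<longleftrightarrow> i \<in> {1..n}"
  and Y_in_vars [simp]: "Y i \<in> vars n \<longleftrightarrow> i \<in> {1..n}"
  by (auto simp: vars_def)

lemma carrier_X: "i \<in> {1..n} \<Longrightarrow> indet (X i) \<in> carrier (poly_ring n)"
  and carrier_Y: "i \<in> {1..n} \<Longrightarrow> indet (Y i) \<in> carrier (poly_ring n)"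
  unfolding indet_def by (intro carrier_single; simp)+

lemma carrier_minor: "u \<in> {1..n} \<Longrightarrow> v \<in> {1..n} \<Longrightarrow> minor u v \<in> carrier (poly_ring n)"
  unfolding minor_def by (intro carrier_diff carrier_mult carrier_X carrier_Y)

lemma cring_poly_ring: "cring (poly_ring n)"
proof (rule cringI)
  show "abelian_group (poly_ring n)"
  proof (rule abelian_groupI)
    fix f assume "f \<in> carrier (poly_ring n)"
    then show "\<exists>g\<in>carrier (poly_ring n). g \<oplus>\<^bsub>poly_ring n\<^esub> f = \<zero>\<^bsub>poly_ring n\<^esub>"
      using carrier_uminus by (intro bexI[of _ "- f"]) auto
  qed (simp_all add: carrier_add ac_simps)
  show "Group.comm_monoid (poly_ring n)"
    by (rule comm_monoidI) (simp_all add: carrier_mult ac_simps)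
qed (simp add: distrib_right)

lemma ring_poly_ring: "ring (poly_ring n)"
  using cring_poly_ring cring.axioms(1) by blast

lemma a_inv_poly_ring: "f \<in> carrier (poly_ring n) \<Longrightarrow> \<ominus>\<^bsub>poly_ring n\<^esub> f = - f"
  using abelian_group.minus_equality[OF ring.is_abelian_group[OF ring_poly_ring[of n]], of "- f" f]
  by (simp add: carrier_uminus)

lemma ideal_poly_ring_iff:
  "ideal I (poly_ring n) \<longleftrightarrow> I \<subseteq> carrier (poly_ring n) \<and> 0 \<in> I \<and> (\<forall>f\<in>I. \<forall>g\<in>I. f + g \<in> I) \<and>
    (\<forall>f\<in>I. \<forall>g\<in>carrier (poly_ring n). g * f \<in> I)" (is "?L \<longleftrightarrow> ?R")
proof
  assume ?L
  then interpret ideal I "poly_ring n" .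
  show ?R
    using a_subset additive_subgroup.zero_closed[OF is_additive_subgroup]
      additive_subgroup.a_closed[OF is_additive_subgroup] I_l_closed by auto
next
  assume R: ?R
  have "- f \<in> I" if "f \<in> I" for f
  proof -
    have "(- 1) * f \<in> I" using R that carrier_uminus[OF carrier_one] by blast
    then show ?thesis by simp
  qed
  then have "subgroup I (add_monoid (poly_ring n))"
    using R a_inv_poly_ring unfolding subgroup_def a_inv_def by auto
  then show ?L
    using R by (intro idealI ring_poly_ring) (auto simp: mult.commute)
qed

text \<open>With \<open>h = comp_label E T\<close> this is the ideal P_T of the overview; the lower
  bound also uses other labellings.\<close>

definition ker_ideal :: "nat \<Rightarrow> nat set \<Rightarrow> (nat \<Rightarrow> nat) \<Rightarrow> mpoly set" where
  "ker_ideal n T h = {f \<in> carrier (poly_ring n). phi n T h f = 0}"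

lemma ideal_ker_ideal: "ideal (ker_ideal n T h) (poly_ring n)"
  unfolding ideal_poly_ring_iff ker_ideal_def
  by (auto simp: carrier_add carrier_mult phi_add phi_mult)

lemma primeideal_ker_ideal: "primeideal (ker_ideal n T h) (poly_ring n)"
proof (rule primeidealI[OF ideal_ker_ideal cring_poly_ring])
  show "carrier (poly_ring n) \<noteq> ker_ideal n T h"
  proof
    assume "carrier (poly_ring n) = ker_ideal n T h"
    then have "1 \<in> ker_ideal n T h" using carrier_one by blast
    then show False by (simp add: ker_ideal_def)
  qed
qed (auto simp: ker_ideal_def phi_mult)

subsection \<open>Binomial edge ideals as intersections of kernels\<close>

definition edges_avoiding :: "nat set set \<Rightarrow> nat set \<Rightarrow> (nat \<times> nat) set" where
  "edges_avoiding E T = {(u, v). {u, v} \<in> E \<and> u \<notin> T \<and> v \<notin> T}"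

text \<open>The least vertex of the component of \<open>u\<close> serves as its name; a vertex of
  \<open>T\<close> is isolated and names itself.\<close>

definition comp_label :: "nat set set \<Rightarrow> nat set \<Rightarrow> nat \<Rightarrow> nat" where
  "comp_label E T u = (LEAST v. (u, v) \<in> (edges_avoiding E T)\<^sup>*)"

text \<open>Such an \<open>h\<close> may give several components the same label; its kernel still
  contains the edge ideal.\<close>

definition const_on_edges :: "nat set set \<Rightarrow> nat set \<Rightarrow> (nat \<Rightarrow> nat) \<Rightarrow> bool" where
  "const_on_edges E T h \<longleftrightarrow> (\<forall>(u, v)\<in>edges_avoiding E T. h u = h v)"

lemma sym_edges_avoiding: "sym (edges_avoiding E T)"
  by (auto simp: edges_avoiding_def sym_def insert_commute)

lemma comp_label_eq_iff: "comp_label E T u = comp_label E T v \<longleftrightarrow> (u, v) \<in> (edges_avoiding E T)\<^sup>*"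
proof
  have L: "(u, comp_label E T u) \<in> (edges_avoiding E T)\<^sup>*" for u
    unfolding comp_label_def by (rule LeastI[of _ u]) simp
  have sym: "sym ((edges_avoiding E T)\<^sup>*)"
    by (intro sym_rtrancl sym_edges_avoiding)
  show "(u, v) \<in> (edges_avoiding E T)\<^sup>*" if "comp_label E T u = comp_label E T v"
    using L[of u] L[of v] that sym by (metis rtrancl_trans symE)
  show "comp_label E T u = comp_label E T v" if "(u, v) \<in> (edges_avoiding E T)\<^sup>*"
  proof -
    have "(u, w) \<in> (edges_avoiding E T)\<^sup>* \<longleftrightarrow> (v, w) \<in> (edges_avoiding E T)\<^sup>*" for w
      using that sym by (meson rtrancl_trans symE)
    then show ?thesis by (simp add: comp_label_def)
  qed
qed

lemma const_on_edgesD: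
  "const_on_edges E T h \<Longrightarrow> comp_label E T u = comp_label E T v \<Longrightarrow> h u = h v"
  unfolding comp_label_eq_iff
  by (rotate_tac 1, induction rule: rtrancl_induct) (auto simp: const_on_edges_def)

lemma const_on_edges_comp_label: "const_on_edges E T (comp_label E T)"
  by (auto simp: const_on_edges_def comp_label_eq_iff)

lemma comp_label_edge: "{u, v} \<in> E \<Longrightarrow> u \<notin> T \<Longrightarrow> v \<notin> T \<Longrightarrow> comp_label E T u = comp_label E T v"
  using const_on_edges_comp_label[of E T] by (auto simp: const_on_edges_def edges_avoiding_def)

lemma comp_label_mono:
  assumes "S \<subseteq> T" "comp_label E T u = comp_label E T v"
  shows "comp_label E S u = comp_label E S v"
proof (rule const_on_edgesD[OF _ assms(2)])
  show "const_on_edges E T (comp_label E S)"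
    using assms(1) comp_label_edge[of _ _ E S] by (auto simp: const_on_edges_def edges_avoiding_def)
qed

section \<open>Generators of the ideal and its containment in the kernels\<close>

lemma ideal_binomial_edge_ideal:
  assumes "\<Union>E \<subseteq> {1..n}"
  shows "ideal (binomial_edge_ideal n E) (poly_ring n)"
  unfolding binomial_edge_ideal_def minor_def[symmetric]
  using assms by (intro ring.genideal_ideal[OF ring_poly_ring]) (fastforce intro: carrier_minor)

lemma minor_in_binomial_edge_ideal:
  assumes "\<Union>E \<subseteq> {1..n}" "{u, v} \<in> E"
  shows "minor u v \<in> binomial_edge_ideal n E"
proof -
  let ?J = "binomial_edge_ideal n E"
  have ideal: "ideal ?J (poly_ring n)" by (rule ideal_binomial_edge_ideal[OF assms(1)])
  have gen: "minor i j \<in> ?J" if "{i, j} \<in> E" "i < j" for i j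
  proof -
    have "{minor i j |i j. {i, j} \<in> E \<and> i < j} \<subseteq> carrier (poly_ring n)"
      using assms(1) by (fastforce intro: carrier_minor)
    from ring.genideal_self[OF ring_poly_ring this] show ?thesis
      unfolding binomial_edge_ideal_def minor_def[symmetric] using that by blast
  qed
  consider "u < v" | "u = v" | "v < u" by linarith
  then show ?thesis
  proof cases
    case 1 then show ?thesis using gen assms(2) by simp
  next
    case 2 then show ?thesis using ideal by (simp add: minor_def ideal_poly_ring_iff)
  next
    case 3
    then have "minor v u \<in> ?J" using gen[of v u] assms(2) by (simp add: insert_commute)
    then have "(- 1) * minor v u \<in> ?J"
      using ideal carrier_uminus[OF carrier_one] unfolding ideal_poly_ring_iff by blast
    then show ?thesis by (simp add: minor_def)
  qed
qed

lemma binomial_edge_ideal_subset_ker_ideal: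
  assumes "\<Union>E \<subseteq> {1..n}" "const_on_edges E T h"
  shows "binomial_edge_ideal n E \<subseteq> ker_ideal n T h"
  unfolding binomial_edge_ideal_def minor_def[symmetric]
proof (rule ring.genideal_minimal[OF ring_poly_ring ideal_ker_ideal])
  show "{minor i j |i j. {i, j} \<in> E \<and> i < j} \<subseteq> ker_ideal n T h"
  proof clarify
    fix i j assume ij: "{i, j} \<in> E"
    then have "i \<in> {1..n}" "j \<in> {1..n}" using assms(1) by auto
    moreover have "i \<in> T \<or> j \<in> T \<or> h i = h j"
      using ij assms(2) by (auto simp: const_on_edges_def edges_avoiding_def)
    ultimately show "minor i j \<in> ker_ideal n T h"
      unfolding ker_ideal_def using phi_minor_eq_0 carrier_minor by blast
  qed
qed

section \<open>Monomials modulo the ideal\<close>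

definition mono_cong :: "mpoly set \<Rightarrow> mono \<Rightarrow> mono \<Rightarrow> bool" where
  "mono_cong J m m' \<longleftrightarrow> single m 1 - single m' 1 \<in> J"

lemma mono_cong_trans:
  assumes "ideal J (poly_ring n)" "mono_cong J a b" "mono_cong J b c"
  shows "mono_cong J a c"
proof -
  have "(single a 1 - single b 1) + (single b 1 - single c 1) \<in> J"
    using assms unfolding mono_cong_def ideal_poly_ring_iff by blast
  then show ?thesis by (simp add: mono_cong_def)
qed

lemma mono_cong_minor:
  assumes "ideal J (poly_ring n)" "minor u v \<in> J" "keys k \<subseteq> vars n"
  shows "mono_cong J (k + single (X u) 1 + single (Y v) 1) (k + single (Y u) 1 + single (X v) 1)"
proof -
  have "single k 1 * minor u v \<in> J"
    using assms carrier_single[of k n 1] unfolding ideal_poly_ring_iff by blast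
  then show ?thesis
    by (simp add: mono_cong_def minor_def indet_def mult_single right_diff_distrib ac_simps)
qed

lemma keys_add_mono: "keys (a + b) = keys a \<union> keys (b :: 'a \<Rightarrow>\<^sub>0 nat)"
  by (auto simp: in_keys_iff lookup_add)

lemma obtain_mono_factor:
  fixes m :: mono
  assumes "lookup m v > 0"
  obtains k where "m = k + single v 1"
proof
  show "m = (m - single v 1) + single v 1"
    by (rule poly_mapping_eqI) (use assms in \<open>auto simp: lookup_add lookup_minus lookup_single when_def\<close>)
qed

text \<open>
  Think of the exponent of \<open>y\<^sub>i\<close> as a number of tokens on vertex \<open>i\<close>, whose capacity is the total
  degree in \<open>x\<^sub>i, y\<^sub>i\<close>. An edge generator moves one token along an edge; a full vertex on the way
  is no obstacle, since it can first pass on one of its own tokens.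
\<close>

lemma mono_cong_move:
  assumes J: "ideal J (poly_ring n)" and E: "\<And>u v. {u, v} \<in> E \<Longrightarrow> minor u v \<in> J"
    and "\<Union>E \<subseteq> {1..n}"
    and "(u, v) \<in> (edges_avoiding E T)\<^sup>*"
    and "keys (k + single (Y u) 1 + single (X v) 1) \<subseteq> vars n"
    and "\<And>w. w \<in> {1..n} \<Longrightarrow> w \<notin> T \<Longrightarrow> mdeg (k + single (Y u) 1 + single (X v) 1) w > 0"
  shows "mono_cong J (k + single (Y u) 1 + single (X v) 1) (k + single (X u) 1 + single (Y v) 1)"
  using assms(4-6)
proof (induction arbitrary: k rule: converse_rtrancl_induct)
  case base
  have "0 \<in> J" using J by (simp add: ideal_poly_ring_iff)
  then show ?case by (simp add: mono_cong_def ac_simps)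
next
  case (step u w)
  let ?m = "k + single (Y u) 1 + single (X v) 1"
  from step.hyps have uw: "{u, w} \<in> E" "w \<notin> T" by (auto simp: edges_avoiding_def)
  with assms(3) have range: "u \<in> {1..n}" "w \<in> {1..n}" by auto
  have "mdeg ?m w > 0" using step.prems(2) uw range by blast
  \<comment> \<open>In case 3 vertex \<open>w\<close> has a free place: the token from
    \<open>u\<close> enters it and the induction hypothesis carries one on to \<open>v\<close>. In
    case 4 \<open>w\<close> holds a token: that one goes to \<open>v\<close> first, then
    \<open>u\<close> refills \<open>w\<close>.\<close>
  then consider "u = w" | "v = w" "u \<noteq> w" | "u \<noteq> w" "v \<noteq> w" "lookup k (X w) > 0" | "u \<noteq> w" "v \<noteq> w" "lookup k (Y w) > 0"
    by (auto simp: mdeg_def lookup_add lookup_single when_def split: if_splits)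
  then show ?case
  proof cases
    case 1 then show ?thesis using step by simp
  next
    case 2
    have "keys k \<subseteq> vars n" using step.prems(1) by (simp add: keys_add_mono)
    then show ?thesis using mono_cong_minor[OF J E[of w u], of k] uw 2 by (simp add: insert_commute ac_simps)
  next
    case 3
    then obtain k' where k': "k = k' + single (X w) 1" by (elim obtain_mono_factor)
    have K: "keys k' \<subseteq> vars n" "v \<in> {1..n}"
      using step.prems(1) by (auto simp: k' keys_add_mono)
    have "mono_cong J (k' + single (X v) 1 + single (X w) 1 + single (Y u) 1)
        (k' + single (X v) 1 + single (Y w) 1 + single (X u) 1)"
      using K uw by (intro mono_cong_minor[OF J E]) (auto simp: keys_add_mono insert_commute)
    moreover have "mono_cong J (k' + single (X u) 1 + single (Y w) 1 + single (X v) 1)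
        (k' + single (X u) 1 + single (X w) 1 + single (Y v) 1)"
      using K range step.prems(2)
      by (intro step.IH) (auto simp: keys_add_mono mdeg_add k' ac_simps split: if_splits)
    ultimately show ?thesis
      using mono_cong_trans[OF J] by (simp add: k' ac_simps)
  next
    case 4
    then obtain k' where k': "k = k' + single (Y w) 1" by (elim obtain_mono_factor)
    have K: "keys k' \<subseteq> vars n" "v \<in> {1..n}"
      using step.prems(1) by (auto simp: k' keys_add_mono)
    have "mono_cong J (k' + single (Y u) 1 + single (Y w) 1 + single (X v) 1)
        (k' + single (Y u) 1 + single (X w) 1 + single (Y v) 1)"
      using K range step.prems(2)
      by (intro step.IH) (auto simp: keys_add_mono mdeg_add k' ac_simps split: if_splits)
    moreover have "mono_cong J (k' + single (Y v) 1 + single (X w) 1 + single (Y u) 1)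
        (k' + single (Y v) 1 + single (Y w) 1 + single (X u) 1)"
      using K uw by (intro mono_cong_minor[OF J E]) (auto simp: keys_add_mono insert_commute)
    ultimately show ?thesis
      using mono_cong_trans[OF J] by (simp add: k' ac_simps)
  qed
qed

lemma mono_eqI:
  fixes m m' :: mono
  assumes "keys m \<subseteq> vars n" "keys m' \<subseteq> vars n"
    and "\<And>i. i \<in> {1..n} \<Longrightarrow> mdeg m i = mdeg m' i"
    and "\<And>i. i \<in> {1..n} \<Longrightarrow> lookup m (Y i) = lookup m' (Y i)"
  shows "m = m'"
proof (rule poly_mapping_eqI)
  fix v
  show "lookup m v = lookup m' v"
  proof (cases "v \<in> vars n")
    case True
    then obtain i where "i \<in> {1..n}" "v = X i \<or> v = Y i" by (auto simp: vars_def)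
    then show ?thesis using assms(3)[of i] assms(4)[of i] by (auto simp: mdeg_def)
  next
    case False
    then have "v \<notin> keys m" "v \<notin> keys m'" using assms(1,2) by auto
    then show ?thesis by (simp add: in_keys_iff)
  qed
qed

text \<open>Equal totals on each component mean that a vertex with surplus tokens shares its
  component with one in deficit; one move between them lowers the surplus. Truncated subtraction
  makes the induction measure count surplus only.\<close>

lemma mono_cong_of_theta_eq:
  assumes J: "ideal J (poly_ring n)" and E: "\<And>u v. {u, v} \<in> E \<Longrightarrow> minor u v \<in> J" "\<Union>E \<subseteq> {1..n}"
    and "theta n (comp_label E T) m = theta n (comp_label E T) m'"
    and "keys m \<subseteq> vars n" "keys m' \<subseteq> vars n"
    and "\<And>w. w \<in> {1..n} \<Longrightarrow> w \<notin> T \<Longrightarrow> mdeg m w > 0"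
  shows "mono_cong J m m'"
  using assms(4-7)
proof (induction "\<Sum>i\<in>{1..n}. lookup m (Y i) - lookup m' (Y i)" arbitrary: m rule: less_induct)
  case less
  let ?h = "comp_label E T"
  let ?y = "\<lambda>i. lookup m (Y i)" and ?y' = "\<lambda>i. lookup m' (Y i)"
  have deg: "mdeg m i = mdeg m' i" if "i \<in> {1..n}" for i
    using less.prems(1) that unfolding theta_eq_iff by blast
  have tot: "(\<Sum>i\<in>{i \<in> {1..n}. ?h i = l}. ?y i) = (\<Sum>i\<in>{i \<in> {1..n}. ?h i = l}. ?y' i)" for l
    using less.prems(1) unfolding theta_eq_iff by blast
  show ?case
  proof (cases "\<forall>i\<in>{1..n}. ?y i = ?y' i")
    case True
    then have "m = m'" using deg less.prems by (intro mono_eqI[of m n m']) auto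
    then show ?thesis using J by (simp add: mono_cong_def ideal_poly_ring_iff)
  next
    case False
    then obtain i where i: "i \<in> {1..n}" "?y i \<noteq> ?y' i" by auto
    let ?A = "{j \<in> {1..n}. ?h j = ?h i}"
    have iA: "i \<in> ?A" "finite ?A" using i by auto
    obtain u where u: "u \<in> ?A" "?y u > ?y' u"
    proof (rule ccontr)
      assume "\<not> thesis"
      then have le: "\<And>j. j \<in> ?A \<Longrightarrow> ?y j \<le> ?y' j" using that by (meson not_le)
      then have "?y i < ?y' i" using i iA by (metis le_neq_implies_less)
      then have "sum ?y ?A < sum ?y' ?A" using le iA by (intro sum_strict_mono_ex1) auto
      then show False using tot[of "?h i"] by simp
    qed
    obtain v where v: "v \<in> ?A" "?y v < ?y' v"
    proof (rule ccontr)
      assume "\<not> thesis"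
      then have le: "\<And>j. j \<in> ?A \<Longrightarrow> ?y' j \<le> ?y j" using that by (meson not_le)
      then have "sum ?y' ?A < sum ?y ?A" using u iA by (intro sum_strict_mono_ex1) auto
      then show False using tot[of "?h i"] by simp
    qed
    have uv: "u \<in> {1..n}" "v \<in> {1..n}" "?h u = ?h v" "u \<noteq> v" using u v by auto
    have "lookup m (Y u) > 0" using u by simp
    then obtain k1 where k1: "m = k1 + single (Y u) 1" by (elim obtain_mono_factor)
    have "lookup m (X v) > 0" using deg[OF uv(2)] v by (auto simp: mdeg_def)
    then have "lookup k1 (X v) > 0" by (simp add: k1 lookup_add lookup_single)
    then obtain k where "k1 = k + single (X v) 1" by (elim obtain_mono_factor)
    then have k: "m = k + single (Y u) 1 + single (X v) 1" by (simp add: k1 ac_simps)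
    let ?m = "k + single (X u) 1 + single (Y v) 1"
    have move: "mono_cong J m ?m"
      using mono_cong_move[OF J E(1) E(2), of u v T k] uv less.prems(2,4) unfolding k comp_label_eq_iff
      by blast
    have Ym: "lookup ?m (Y j) = (if j = u then ?y j - 1 else if j = v then ?y j + 1 else ?y j)" for j
      using uv(4) by (auto simp: k lookup_add lookup_single when_def)
    have "(\<Sum>j\<in>{1..n}. lookup ?m (Y j) - ?y' j) < (\<Sum>j\<in>{1..n}. ?y j - ?y' j)"
    proof (rule sum_strict_mono_ex1)
      show "\<forall>j\<in>{1..n}. lookup ?m (Y j) - ?y' j \<le> ?y j - ?y' j"
        using v unfolding Ym by auto
      show "\<exists>j\<in>{1..n}. lookup ?m (Y j) - ?y' j < ?y j - ?y' j"
        using u uv(1) unfolding Ym by (intro bexI[of _ u]) auto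
    qed simp
    moreover have "theta n ?h ?m = theta n ?h m"
      using uv(1,2) by (simp add: k theta_add uv(3) theta_single_X[unfolded One_nat_def] 
          theta_single_Y[unfolded One_nat_def] ac_simps)
    moreover have "keys ?m \<subseteq> vars n"
      using less.prems(2) uv by (auto simp: k keys_add_mono)
    moreover have "mdeg ?m w > 0" if "w \<in> {1..n}" "w \<notin> T" for w
      using less.prems(4)[OF that] by (simp add: k mdeg_add)
    ultimately have "mono_cong J ?m m'"
      using less.prems by (intro less.hyps) auto
    then show ?thesis using move mono_cong_trans[OF J] by blast
  qed
qed

text \<open>In each class of \<open>k\<close> the coefficients sum to 0, so replacing every monomial
  by its difference with a fixed representative \<open>m0\<close> does not change the sum, and these
  differences lie in \<open>J\<close>.\<close>

lemma sum_single_diff_in_ideal: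
  assumes J: "ideal J (poly_ring n)"
    and "\<And>w. (\<Sum>m\<in>{m \<in> keys f. k m = w}. lookup f m) = 0"
    and "\<And>m m'. m \<in> keys f \<Longrightarrow> m' \<in> keys f \<Longrightarrow> k m = k m' \<Longrightarrow> mono_cong J m m'"
  shows "f \<in> J"
proof -
  have single_sum: "single m0 (sum F A) = (\<Sum>a\<in>A. single m0 (F a))"
    for m0 :: mono and F :: "mono \<Rightarrow> complex" and A
    by (induction A rule: infinite_finite_induct) (simp_all add: single_add)
  have sum_in: "sum F A \<in> J" if "\<And>a. a \<in> A \<Longrightarrow> F a \<in> J" for F and A :: "'b set"
    using that J by (induction A rule: infinite_finite_induct) (auto simp: ideal_poly_ring_iff)
  have sum_in': "sum F A \<in> J" if "\<And>a. a \<in> A \<Longrightarrow> F a \<in> J" for F and A :: "mono set"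
    using that J by (induction A rule: infinite_finite_induct) (auto simp: ideal_poly_ring_iff)
  have "f = (\<Sum>w\<in>k ` keys f. \<Sum>m\<in>{m \<in> keys f. k m = w}. single m (lookup f m))"
    by (subst sum.image_gen[symmetric]) (simp_all add: sum_single_keys)
  also have "\<dots> \<in> J"
  proof (rule sum_in)
    fix w assume "w \<in> k ` keys f"
    then obtain m0 where m0: "m0 \<in> keys f" "k m0 = w" by auto
    let ?A = "{m \<in> keys f. k m = w}"
    have "(\<Sum>m\<in>?A. single m0 (lookup f m)) = single m0 (\<Sum>m\<in>?A. lookup f m)"
      by (simp only: single_sum)
    then have "(\<Sum>m\<in>?A. single m (lookup f m)) = (\<Sum>m\<in>?A. single 0 (lookup f m) * (single m 1 - single m0 1))"
      using assms(2)[of w] by (simp add: right_diff_distrib mult_single sum_subtractf)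
    also have "\<dots> \<in> J"
    proof (rule sum_in')
      fix m assume "m \<in> ?A"
      then have "single m 1 - single m0 1 \<in> J"
        using m0 assms(3)[of m m0] by (simp add: mono_cong_def)
      then show "single 0 (lookup f m) * (single m 1 - single m0 1) \<in> J"
        using J carrier_single[of 0 n "lookup f m"] by (simp add: ideal_poly_ring_iff)
    qed
    finally show "(\<Sum>m\<in>?A. single m (lookup f m)) \<in> J" .
  qed
  finally show ?thesis .
qed

text \<open>In particular binomial edge ideals are radical.\<close>

theorem binomial_edge_ideal_eq_Inter:
  assumes "\<Union>E \<subseteq> {1..n}"
  shows "binomial_edge_ideal n E = (\<Inter>T\<in>Pow {1..n}. ker_ideal n T (comp_label E T))" (is "?J = ?I")
proof
  show "?J \<subseteq> ?I"
    using binomial_edge_ideal_subset_ker_ideal[OF assms const_on_edges_comp_label] by blast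
  show "?I \<subseteq> ?J"
  proof
    fix f assume f: "f \<in> ?I"
    then have fc: "f \<in> carrier (poly_ring n)" by (auto simp: ker_ideal_def)
    \<comment> \<open>The right \<open>T\<close> for a monomial is the set of vertices it does not
      meet: its degree is then positive outside \<open>T\<close>, as moving tokens requires.\<close>
    define Z where "Z m = {i \<in> {1..n}. mdeg m i = 0}" for m
    define k where "k m = (Z m, theta n (comp_label E (Z m)) m)" for m
    show "f \<in> ?J"
    proof (rule sum_single_diff_in_ideal[OF ideal_binomial_edge_ideal[OF assms], where k = k])
      fix w :: "nat set \<times> (nat \<Rightarrow>\<^sub>0 nat)"
      obtain T w' where w: "w = (T, w')" by (cases w)
      show "(\<Sum>m\<in>{m \<in> keys f. k m = w}. lookup f m) = 0"
      proof (cases "{m \<in> keys f. k m = w} = {}")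
        case True
        then show ?thesis by (simp only: sum.empty)
      next
        case False
        then obtain m0 where m0: "m0 \<in> keys f" "Z m0 = T" "theta n (comp_label E T) m0 = w'"
          by (auto simp: k_def w)
        have TZ: "T \<subseteq> {1..n}" using m0 by (auto simp: Z_def)
        \<comment> \<open>\<open>theta\<close> determines the multidegree and hence
          \<open>Z\<close>, so one class of \<open>k\<close> is a whole fibre for this
          \<open>T\<close>.\<close>
        have "{m \<in> keys f. k m = w} = {m \<in> keys f. avoids T m \<and> theta n (comp_label E T) m = w'}"
        proof (intro equalityI subsetI)
          fix m assume "m \<in> {m \<in> keys f. k m = w}"
          then show "m \<in> {m \<in> keys f. avoids T m \<and> theta n (comp_label E T) m = w'}"
            by (auto simp: k_def w avoids_def Z_def)
        next
          fix m assume m: "m \<in> {m \<in> keys f. avoids T m \<and> theta n (comp_label E T) m = w'}"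
          then have "\<forall>i\<in>{1..n}. mdeg m i = mdeg m0 i"
            using m0 mdeg_eq_of_theta_eq[of n "comp_label E T" m "comp_label E T" m0] by simp
          then have "Z m = T" using m0 by (auto simp: Z_def)
          then show "m \<in> {m \<in> keys f. k m = w}" using m by (simp add: k_def w)
        qed
        then have "(\<Sum>m\<in>{m \<in> keys f. k m = w}. lookup f m) = lookup (phi n T (comp_label E T) f) w'"
          by (simp only: lookup_phi)
        also have "\<dots> = 0" using f TZ by (auto simp: ker_ideal_def)
        finally show ?thesis .
      qed
    next
      fix m m' assume m: "m \<in> keys f" "m' \<in> keys f" "k m = k m'"
      show "mono_cong ?J m m'"
      proof (rule mono_cong_of_theta_eq[OF ideal_binomial_edge_ideal[OF assms] _ assms])
        show "theta n (comp_label E (Z m)) m = theta n (comp_label E (Z m)) m'"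
          using m(3) unfolding k_def prod.inject by metis
      qed (use m fc minor_in_binomial_edge_ideal[OF assms] in \<open>auto simp: carrier_iff Z_def\<close>)
    qed
  qed
qed

subsection \<open>Prime colon ideals\<close>

lemma primeideal_prod:
  assumes "primeideal P (poly_ring n)" "finite A"
    and "\<And>a. a \<in> A \<Longrightarrow> F a \<in> carrier (poly_ring n) - P"
  shows "prod F A \<notin> P"
  using assms(2,3)
proof (induction A rule: finite_induct)
  case empty
  interpret primeideal P "poly_ring n" by fact
  show ?case using I_notcarr one_imp_carrier by auto
next
  case (insert a A)
  interpret primeideal P "poly_ring n" by fact
  have "F a \<in> carrier (poly_ring n)" "F a \<notin> P" "prod F A \<notin> P" "prod F A \<in> carrier (poly_ring n)"
    using insert by (auto intro!: carrier_prod)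
  then show ?case using I_prime[of "F a" "prod F A"] insert.hyps by auto
qed

text \<open>If no kernel lay in the colon ideal, a product of elements outside it, one from each
  kernel, would lie in the intersection of the kernels, which is the edge ideal; this contradicts
  primality. If \<open>f\<close> were in the kernel found, \<open>f * f\<close> would be in the edge
  ideal and so \<open>f\<close> in every kernel, making the colon ideal improper.\<close>

lemma prime_colon_component:
  assumes E: "\<Union>E \<subseteq> {1..n}" and f: "f \<in> carrier (poly_ring n)"
    and P: "primeideal (colon (poly_ring n) (binomial_edge_ideal n E) f) (poly_ring n)"
  obtains S where "S \<subseteq> {1..n}" "phi n S (comp_label E S) f \<noteq> 0"
    "\<forall>g\<in>ker_ideal n S (comp_label E S). g * f \<in> binomial_edge_ideal n E"
proof -
  let ?J = "binomial_edge_ideal n E" and ?P = "colon (poly_ring n) (binomial_edge_ideal n E) f"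
  let ?K = "\<lambda>T. ker_ideal n T (comp_label E T)"
  have J: "?J = (\<Inter>T\<in>Pow {1..n}. ?K T)" by (rule binomial_edge_ideal_eq_Inter[OF E])
  have "\<exists>S\<in>Pow {1..n}. ?K S \<subseteq> ?P"
  proof (rule ccontr)
    assume "\<not> ?thesis"
    then have "\<forall>S\<in>Pow {1..n}. \<exists>g. g \<in> ?K S \<and> g \<notin> ?P" by blast
    then obtain G where G: "\<And>S. S \<in> Pow {1..n} \<Longrightarrow> G S \<in> ?K S \<and> G S \<notin> ?P" by metis
    then have carr: "\<And>S. S \<in> Pow {1..n} \<Longrightarrow> G S \<in> carrier (poly_ring n)" by (auto simp: ker_ideal_def)
    have "prod G (Pow {1..n}) \<notin> ?P"
      using G carr by (intro primeideal_prod[OF P]) auto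
    moreover have "prod G (Pow {1..n}) \<in> ?K T" if "T \<in> Pow {1..n}" for T
    proof -
      have "phi n T (comp_label E T) (G T) = 0" using G[OF that] by (simp add: ker_ideal_def)
      then have "phi n T (comp_label E T) (prod G (Pow {1..n})) = 0"
        unfolding phi_prod using that by (intro prod_zero) auto
      then show ?thesis using carr by (auto simp: ker_ideal_def intro!: carrier_prod)
    qed
    then have "prod G (Pow {1..n}) \<in> ?J" unfolding J by blast
    then have "prod G (Pow {1..n}) * f \<in> ?J"
      using ideal_binomial_edge_ideal[OF E] f unfolding ideal_poly_ring_iff by (metis mult.commute)
    then have "prod G (Pow {1..n}) \<in> ?P"
      using carr by (auto simp: colon_def intro!: carrier_prod)
    ultimately show False by blast
  qed
  then obtain S where S: "S \<subseteq> {1..n}" "?K S \<subseteq> ?P" by auto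
  have "f \<notin> ?J"
  proof
    assume "f \<in> ?J"
    then have "?P = carrier (poly_ring n)"
      using ideal_binomial_edge_ideal[OF E] by (auto simp: colon_def ideal_poly_ring_iff)
    then show False using primeideal.I_notcarr[OF P] by simp
  qed
  then obtain T where T: "T \<in> Pow {1..n}" "f \<notin> ?K T" unfolding J by blast
  have mult_J: "g * f \<in> ?J" if "g \<in> ?K S" for g
    using S that by (auto simp: colon_def)
  have "phi n S (comp_label E S) f \<noteq> 0"
  proof
    assume "phi n S (comp_label E S) f = 0"
    then have "f * f \<in> ?J" using mult_J f by (simp add: ker_ideal_def)
    then have "f * f \<in> ?K T" using T unfolding J by blast
    then show False using T f by (simp add: ker_ideal_def phi_mult)
  qed
  then show ?thesis using that S mult_J by blast
qed

text \<open>A fibre of \<open>theta\<close> lies in a single multidegree, so restricting to one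
  multidegree keeps it whole or drops it.\<close>

lemma phi_restr_eq_0:
  assumes "phi n T h f = 0"
  shows "phi n T h (restr (\<lambda>m. \<forall>i\<in>{1..n}. mdeg m i = a i) f) = 0" (is "phi n T h (restr ?Q f) = 0")
proof (rule poly_mapping_eqI)
  fix w
  let ?A = "{m \<in> keys (restr ?Q f). avoids T m \<and> theta n h m = w}"
  let ?B = "{m \<in> keys f. avoids T m \<and> theta n h m = w}"
  have AB: "?A = {m \<in> ?B. ?Q m}" by (auto simp: keys_restr)
  have "lookup (phi n T h (restr ?Q f)) w = (\<Sum>m\<in>?A. lookup f m)"
    unfolding lookup_phi by (intro sum.cong) (auto simp: lookup_restr keys_restr)
  also have "\<dots> = 0"
  proof (cases "?A = {}")
    case True
    then show ?thesis by (simp only: sum.empty)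
  next
    case False
    then obtain m0 where m0: "m0 \<in> ?B" "?Q m0" unfolding AB by blast
    have "?Q m" if "m \<in> ?B" for m
      using that m0 mdeg_eq_of_theta_eq[of n h m h m0] by auto
    then have "?A = ?B" unfolding AB by blast
    then show ?thesis using assms lookup_phi[of n T h f w] by simp
  qed
  finally show "lookup (phi n T h (restr ?Q f)) w = lookup 0 w" by simp
qed

lemma mon_degree_eq_sum_mdeg:
  assumes "keys m \<subseteq> vars n"
  shows "mon_degree m = (\<Sum>i\<in>{1..n}. mdeg m i)"
proof -
  have "mon_degree m = (\<Sum>v\<in>vars n. lookup m v)"
    unfolding mon_degree_def using assms
    by (intro sum.mono_neutral_left) (auto simp: vars_def in_keys_iff)
  also have "\<dots> = (\<Sum>v\<in>X ` {1..n}. lookup m v) + (\<Sum>v\<in>Y ` {1..n}. lookup m v)"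
    unfolding vars_def by (intro sum.union_disjoint) auto
  also have "\<dots> = (\<Sum>i\<in>{1..n}. mdeg m i)"
    by (simp add: sum.reindex inj_on_def mdeg_def sum.distrib)
  finally show ?thesis .
qed

subsection \<open>Cycles\<close>

definition cyc_succ :: "nat \<Rightarrow> nat \<Rightarrow> nat" where
  "cyc_succ n i = (if i = n then 1 else i + 1)"

definition cyc_pred :: "nat \<Rightarrow> nat \<Rightarrow> nat" where
  "cyc_pred n i = (if i = 1 then n else i - 1)"

lemma cyc_succ_range [simp]: "i \<in> {1..n} \<Longrightarrow> cyc_succ n i \<in> {1..n}"
  and cyc_pred_range [simp]: "i \<in> {1..n} \<Longrightarrow> cyc_pred n i \<in> {1..n}"
  and cyc_succ_pred [simp]: "i \<in> {1..n} \<Longrightarrow> cyc_succ n (cyc_pred n i) = i"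
  and cyc_pred_succ [simp]: "i \<in> {1..n} \<Longrightarrow> cyc_pred n (cyc_succ n i) = i"
  by (auto simp: cyc_succ_def cyc_pred_def)

text \<open>For \<open>n = 3\<close> the last inequality fails, since the second successor is the
  predecessor.\<close>

lemma cyc_neq:
  assumes "n \<ge> 4" "i \<in> {1..n}"
  shows "cyc_succ n i \<noteq> i" "cyc_pred n i \<noteq> i" "cyc_succ n i \<noteq> cyc_pred n i"
    "cyc_succ n (cyc_succ n i) \<noteq> i" "cyc_succ n (cyc_succ n i) \<noteq> cyc_pred n i"
  using assms by (auto simp: cyc_succ_def cyc_pred_def split: if_splits)

lemma cycle_edges_eq: "cycle_edges n = {{i, cyc_succ n i} |i. i \<in> {1..n}}"
  by (simp add: cycle_edges_def cyc_succ_def)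

lemma Union_cycle_edges: "\<Union>(cycle_edges n) \<subseteq> {1..n}"
  unfolding cycle_edges_eq using cyc_succ_range by blast

lemma cycle_edge: "i \<in> {1..n} \<Longrightarrow> {i, cyc_succ n i} \<in> cycle_edges n"
  unfolding cycle_edges_eq by blast

lemma const_on_edges_cycle:
  assumes "\<And>i. \<lbrakk>i \<in> {1..n}; i \<notin> T; cyc_succ n i \<notin> T\<rbrakk> \<Longrightarrow> h i = h (cyc_succ n i)"
  shows "const_on_edges (cycle_edges n) T h"
  unfolding const_on_edges_def edges_avoiding_def
proof clarify
  fix u v assume "{u, v} \<in> cycle_edges n" "u \<notin> T" "v \<notin> T"
  then obtain i where i: "i \<in> {1..n}" "{u, v} = {i, cyc_succ n i}" by (auto simp: cycle_edges_eq)
  then have "i \<notin> T" "cyc_succ n i \<notin> T" using \<open>u \<notin> T\<close> \<open>v \<notin> T\<close> by (metis insert_iff singletonD)+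
  then show "h u = h v" using assms[OF i(1)] i(2) by (metis doubleton_eq_iff)
qed

abbreviation "arc_label n \<equiv> comp_label (cycle_edges n)"

lemma arc_label_succ:
  "\<lbrakk>i \<in> {1..n}; i \<notin> T; cyc_succ n i \<notin> T\<rbrakk> \<Longrightarrow> arc_label n T i = arc_label n T (cyc_succ n i)"
  using comp_label_edge[OF cycle_edge] by blast

lemma arc_label_pred:
  "\<lbrakk>i \<in> {1..n}; i \<notin> T; cyc_pred n i \<notin> T\<rbrakk> \<Longrightarrow> arc_label n T (cyc_pred n i) = arc_label n T i"
  using arc_label_succ[OF cyc_pred_range] cyc_succ_pred by metis

text \<open>Deleting \<open>i\<close> and \<open>j\<close> cuts the cycle into two arcs. The
  indicator \<open>h\<close> of the numbers strictly between them is constant along the remaining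
  edges and differs at the two neighbours of \<open>i\<close>.\<close>

lemma arc_label_separated:
  assumes "i \<in> T" "j \<in> T" "i \<noteq> j" "i \<in> {1..n}" "j \<in> {1..n}"
    and "cyc_pred n i \<notin> T" "cyc_succ n i \<notin> T"
  shows "arc_label n T (cyc_pred n i) \<noteq> arc_label n T (cyc_succ n i)"
proof
  assume eq: "arc_label n T (cyc_pred n i) = arc_label n T (cyc_succ n i)"
  define h :: "nat \<Rightarrow> nat" where "h v = (if min i j < v \<and> v < max i j then 1 else 0)" for v
  have "const_on_edges (cycle_edges n) T h"
  proof (rule const_on_edges_cycle)
    fix v assume v: "v \<in> {1..n}" "v \<notin> T" "cyc_succ n v \<notin> T"
    then have "v \<noteq> i" "v \<noteq> j" "cyc_succ n v \<noteq> i" "cyc_succ n v \<noteq> j" using assms by auto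
    then show "h v = h (cyc_succ n v)"
      using v(1) assms(4,5) by (auto simp: h_def cyc_succ_def split: if_splits)
  qed
  then have h: "h (cyc_pred n i) = h (cyc_succ n i)" using eq by (rule const_on_edgesD)
  have "cyc_pred n i \<noteq> j" "cyc_succ n i \<noteq> j" using assms by auto
  then have "h (cyc_pred n i) \<noteq> h (cyc_succ n i)"
  proof (cases "i < j")
    case True
    then have "h (cyc_succ n i) = 1" "h (cyc_pred n i) = 0"
      using assms(4,5) \<open>cyc_succ n i \<noteq> j\<close> by (auto simp: h_def cyc_pred_def cyc_succ_def)
    then show ?thesis by simp
  next
    case False
    then have "h (cyc_pred n i) = 1" "h (cyc_succ n i) = 0"
      using assms(3-5) \<open>cyc_pred n i \<noteq> j\<close> by (auto simp: h_def cyc_pred_def cyc_succ_def)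
    then show ?thesis by simp
  qed
  then show False using h by simp
qed

subsection \<open>The lower bound\<close>

text \<open>\<open>S\<close> is the set supplied by \<open>prime_colon_component\<close>, and
  \<open>fa\<close> a component of \<open>f\<close> of multidegree \<open>a\<close> with non-zero
  image; the aim is to bound the sum of \<open>a\<close> from below.\<close>

context
  fixes n :: nat and S :: "nat set" and f fa :: mpoly and a :: "nat \<Rightarrow> nat"
  assumes n: "n \<ge> 4" and S: "S \<subseteq> {1..n}" and f: "f \<in> carrier (poly_ring n)"
    and mult_mem: "\<And>g. g \<in> ker_ideal n S (arc_label n S) \<Longrightarrow> g * f \<in> binomial_edge_ideal n (cycle_edges n)"
    and fa_def: "fa = restr (\<lambda>m. \<forall>i\<in>{1..n}. mdeg m i = a i) f"
    and fa_nonzero: "phi n S (arc_label n S) fa \<noteq> 0"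
begin

lemma mdeg_fa: "m \<in> keys fa \<Longrightarrow> i \<in> {1..n} \<Longrightarrow> mdeg m i = a i"
  by (simp add: fa_def keys_restr)

lemma a_eq_0: "s \<in> S \<Longrightarrow> a s = 0"
proof -
  assume s: "s \<in> S"
  obtain m where "m \<in> keys fa" "avoids S m"
    using fa_nonzero unfolding phi_def by (metis (no_types, lifting) mem_Collect_eq sum.neutral empty_iff equals0I sum.empty)
  then show ?thesis using s S mdeg_fa unfolding avoids_def by (metis subsetD)
qed

text \<open>Since \<open>fa\<close> has a single multidegree, killing a vertex with
  \<open>a i = 0\<close> changes nothing and its label is invisible; only labels at positive degree
  need comparing.\<close>

lemma phi_fa_mono:
  assumes "phi n T h fa = 0" "T \<subseteq> {1..n}" "T' \<subseteq> {1..n}" "\<And>i. i \<in> T \<Longrightarrow> a i = 0"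
    and "\<And>u v. \<lbrakk>u \<in> {1..n}; v \<in> {1..n}; a u > 0; a v > 0; h u = h v\<rbrakk> \<Longrightarrow> h' u = h' v"
  shows "phi n T' h' fa = 0"
proof (rule phi_eq_0_mono[OF assms(1)])
  fix m assume "m \<in> keys fa"
  then show "avoids T m" using assms(2,4) mdeg_fa[of m] by (auto simp: avoids_def)
next
  fix m m' assume m: "m \<in> keys fa" "m' \<in> keys fa" "avoids T' m" "theta n h m = theta n h m'"
  have "avoids T' m'"
    unfolding avoids_def
  proof
    fix i assume i: "i \<in> T'"
    then have "mdeg m i = 0" using m(3) by (simp add: avoids_def)
    then show "mdeg m' i = 0" using mdeg_eq_of_theta_eq[OF m(4), of i] i assms(3) by auto
  qed
  moreover have "theta n h' m = theta n h' m'"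
  proof (rule theta_mono[OF m(4)])
    fix u v assume "u \<in> {1..n}" "v \<in> {1..n}" "mdeg m u > 0" "mdeg m v > 0" "h u = h v"
    then show "h' u = h' v" using mdeg_fa[OF m(1)] assms(5)[of u v] by simp
  qed
  ultimately show "avoids T' m' \<and> theta n h' m = theta n h' m'" ..
qed

text \<open>The main source of vanishing: \<open>g * f\<close> is in the edge ideal and so in the
  kernel for \<open>U\<close>, which is prime and does not contain \<open>g\<close>.\<close>

lemma phi_fa_eq_0_of_mult:
  assumes "const_on_edges (cycle_edges n) U h" "g \<in> ker_ideal n S (arc_label n S)" "phi n U h g \<noteq> 0"
  shows "phi n U h fa = 0"
proof -
  have "phi n U h (g * f) = 0"
    using binomial_edge_ideal_subset_ker_ideal[OF Union_cycle_edges assms(1)] mult_mem[OF assms(2)]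
    by (auto simp: ker_ideal_def)
  then have "phi n U h f = 0" using assms(3) by (simp add: phi_mult)
  then show ?thesis unfolding fa_def by (rule phi_restr_eq_0)
qed

lemma phi_fa_eq_0:
  assumes "const_on_edges (cycle_edges n) U h" "s \<in> S" "s \<notin> U"
  shows "phi n U h fa = 0"
proof (rule phi_fa_eq_0_of_mult[OF assms(1)])
  have s: "s \<in> {1..n}" using assms S by blast
  show "indet (X s) \<in> ker_ideal n S (arc_label n S)"
    using s carrier_X[OF s] phi_X[OF s] assms by (simp add: ker_ideal_def)
  show "phi n U h (indet (X s)) \<noteq> 0"
    using phi_X[OF s, of U h] assms(3)
    by (metis keys_single keys_eq_empty insert_not_empty zero_neq_one)
qed

text \<open>If \<open>a c = 0\<close>, kill all vertices of degree 0 except \<open>s\<close>. Then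
  \<open>s\<close> has at most the neighbour \<open>c'\<close> and may take its label without any
  arcs being merged. So \<open>fa\<close> vanishes for a labelling that agrees with the one for
  \<open>S\<close> at positive degree.\<close>

lemma neighbour_pos_aux:
  assumes "s \<in> S" "c \<in> {cyc_succ n s, cyc_pred n s}" "c' \<in> {cyc_succ n s, cyc_pred n s}" "c \<noteq> c'"
  shows "a c > 0"
proof (rule ccontr)
  assume "\<not> a c > 0"
  then have ac: "a c = 0" by simp
  have s: "s \<in> {1..n}" using assms S by blast
  define U where "U = {i \<in> {1..n}. a i = 0 \<and> i \<noteq> s}"
  define h where "h = (arc_label n S)(s := arc_label n S c')"
  have cs: "c \<noteq> s" "c' \<noteq> s" using assms cyc_neq[OF n s] by auto
  have "c \<in> {1..n}" using assms(2) cyc_succ_range[OF s] cyc_pred_range[OF s] by blast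
  then have cU: "c \<in> U" using cs ac by (simp add: U_def)
  have nS: "i \<notin> S" if "i \<in> {1..n}" "i \<notin> U" "i \<noteq> s" for i
    using that a_eq_0 by (auto simp: U_def)
  have "const_on_edges (cycle_edges n) U h"
  proof (rule const_on_edges_cycle)
    fix i assume i: "i \<in> {1..n}" "i \<notin> U" "cyc_succ n i \<notin> U"
    consider "i = s" | "cyc_succ n i = s" | "i \<noteq> s" "cyc_succ n i \<noteq> s" by blast
    then show "h i = h (cyc_succ n i)"
    proof cases
      case 1
      then have "cyc_succ n i = c'" using assms cU i by auto
      then show ?thesis using 1 cs by (simp add: h_def)
    next
      case 2
      then have "i = c'" using assms cU i cyc_pred_succ[OF i(1)] by auto
      then show ?thesis using 2 cs by (simp add: h_def)
    next
      case 3
      then show ?thesis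
        using arc_label_succ[OF i(1) nS[OF i(1,2)] nS[OF cyc_succ_range[OF i(1)] i(3)]] by (simp add: h_def)
    qed
  qed
  then have "phi n U h fa = 0" using assms(1) by (rule phi_fa_eq_0) (simp add: U_def)
  then have "phi n S (arc_label n S) fa = 0"
  proof (rule phi_fa_mono)
    fix u v assume "a u > 0" "a v > 0" "h u = h v"
    moreover have "a s = 0" using a_eq_0 assms by blast
    ultimately show "arc_label n S u = arc_label n S v" by (auto simp: h_def split: if_splits)
  qed (use S in \<open>auto simp: U_def\<close>)
  then show False using fa_nonzero by simp
qed

lemma neighbour_pos:
  assumes "s \<in> S"
  shows "a (cyc_succ n s) > 0" "a (cyc_pred n s) > 0"
proof -
  have "cyc_succ n s \<noteq> cyc_pred n s" using cyc_neq[OF n] S assms by blast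
  then show "a (cyc_succ n s) > 0" "a (cyc_pred n s) > 0"
    using neighbour_pos_aux[OF assms, of "cyc_succ n s" "cyc_pred n s"]
      neighbour_pos_aux[OF assms, of "cyc_pred n s" "cyc_succ n s"] by auto
qed

lemma neighbour_notin:
  assumes "s \<in> S"
  shows "cyc_succ n s \<notin> S" "cyc_pred n s \<notin> S"
proof -
  show "cyc_succ n s \<notin> S"
  proof
    assume "cyc_succ n s \<in> S"
    then show False using neighbour_pos(1)[OF assms] a_eq_0 by fastforce
  qed
  show "cyc_pred n s \<notin> S"
  proof
    assume "cyc_pred n s \<in> S"
    then show False using neighbour_pos(2)[OF assms] a_eq_0 by fastforce
  qed
qed

text \<open>Otherwise the minor of \<open>u\<close> and \<open>v\<close> vanishes for
  \<open>S\<close> but not for \<open>T\<close>, so \<open>fa\<close> vanishes for \<open>T\<close>.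
  The vertices of \<open>T\<close> have degree 0 and its arcs are finer, so \<open>fa\<close> would
  vanish for \<open>S\<close> too.\<close>

lemma arc_label_eq_mono:
  assumes "S \<subseteq> T" "T \<subseteq> {1..n}" "\<And>i. i \<in> T \<Longrightarrow> a i = 0" "u \<in> {1..n} - T" "v \<in> {1..n} - T"
    and "arc_label n S u = arc_label n S v"
  shows "arc_label n T u = arc_label n T v"
proof (rule ccontr)
  assume neq: "arc_label n T u \<noteq> arc_label n T v"
  have "phi n T (arc_label n T) fa = 0"
  proof (rule phi_fa_eq_0_of_mult[OF const_on_edges_comp_label])
    show "minor u v \<in> ker_ideal n S (arc_label n S)"
      using assms(4-6) carrier_minor phi_minor_eq_0 by (auto simp: ker_ideal_def)
    show "phi n T (arc_label n T) (minor u v) \<noteq> 0"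
      using assms(4,5) neq phi_minor_eq_0[of u n v] by blast
  qed
  then have "phi n S (arc_label n S) fa = 0"
  proof (rule phi_fa_mono)
    fix u v assume "arc_label n T u = arc_label n T v"
    then show "arc_label n S u = arc_label n S v" by (rule comp_label_mono[OF assms(1)])
  qed (use S assms(2,3) in simp_all)
  then show False using fa_nonzero by simp
qed

text \<open>The neighbours of \<open>i\<close> lie in one arc for \<open>S\<close>, joined through
  \<open>i\<close>, but in different arcs for \<open>T\<close>, which contains \<open>i\<close> and
  \<open>j\<close>.\<close>

lemma zero_not_cut:
  assumes "S \<subseteq> T" "T \<subseteq> {1..n}" "\<And>i. i \<in> T \<Longrightarrow> a i = 0" "i \<in> T - S" "j \<in> T" "j \<noteq> i"
    and "cyc_succ n i \<notin> T" "cyc_pred n i \<notin> T"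
  shows False
proof -
  have i: "i \<in> {1..n}" "j \<in> {1..n}" using assms by auto
  have "arc_label n S (cyc_pred n i) = arc_label n S (cyc_succ n i)"
    using arc_label_pred[OF i(1), of S] arc_label_succ[OF i(1), of S] assms(1,4,7,8) by fastforce
  then have "arc_label n T (cyc_pred n i) = arc_label n T (cyc_succ n i)"
    using cyc_pred_range[OF i(1)] cyc_succ_range[OF i(1)] assms(7,8)
    by (intro arc_label_eq_mono[OF assms(1-3)]) simp_all
  then show False using arc_label_separated[of i T j n] assms i by blast
qed

text \<open>Neighbours of \<open>S\<close> have positive degree, so a vertex \<open>i\<close> of
  degree 0 outside \<open>S\<close> has no neighbour in \<open>S\<close>, and adding
  \<open>i\<close> to \<open>S\<close> would be a forbidden cut.\<close>

lemma pos_outside: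
  assumes "S \<noteq> {}" "i \<in> {1..n} - S"
  shows "a i > 0"
proof (rule ccontr)
  assume "\<not> a i > 0"
  then have ai: "a i = 0" by simp
  obtain s where s: "s \<in> S" using assms by auto
  have i: "i \<in> {1..n}" using assms by auto
  have "cyc_succ n i \<notin> S"
    using neighbour_pos(2)[of "cyc_succ n i"] ai cyc_pred_succ[OF i] by auto
  moreover have "cyc_pred n i \<notin> S"
    using neighbour_pos(1)[of "cyc_pred n i"] ai cyc_succ_pred[OF i] by auto
  ultimately show False
    using zero_not_cut[of "insert i S" i s] S s ai assms a_eq_0 cyc_neq[OF n i] by auto
qed

text \<open>Two non-adjacent zeros would form a forbidden cut, so zeros are pairwise adjacent; a
  cycle with \<open>n \<ge> 4\<close> has no triangle, which leaves at most two.\<close>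

lemma sum_ge_if_empty:
  assumes "S = {}"
  shows "n \<le> (\<Sum>i\<in>{1..n}. a i) + 2"
proof -
  let ?Z = "{i \<in> {1..n}. a i = 0}"
  have adj: "j \<in> {cyc_succ n i, cyc_pred n i}" if "i \<in> ?Z" "j \<in> ?Z" "i \<noteq> j" for i j
    using zero_not_cut[of "{i, j}" i j] that assms cyc_neq[OF n, of i] by auto
  have "card ?Z \<le> 2"
  proof (cases "?Z = {}")
    case True
    then show ?thesis by (simp only: card.empty)
  next
    case False
    then obtain i where i: "i \<in> ?Z" by blast
    then have iZ: "i \<in> {1..n}" by blast
    have "\<not> (cyc_succ n i \<in> ?Z \<and> cyc_pred n i \<in> ?Z)"
    proof
      assume *: "cyc_succ n i \<in> ?Z \<and> cyc_pred n i \<in> ?Z"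
      have "cyc_pred n i = cyc_succ n (cyc_succ n i) \<or> cyc_pred n i = cyc_pred n (cyc_succ n i)"
        using adj[of "cyc_succ n i" "cyc_pred n i"] * cyc_neq[OF n iZ] by blast
      then show False using cyc_neq[OF n iZ] cyc_pred_succ[OF iZ] by auto
    qed
    then have "?Z \<subseteq> {i, cyc_succ n i} \<or> ?Z \<subseteq> {i, cyc_pred n i}"
      using adj[OF i] by blast
    then obtain x where "?Z \<subseteq> {i, x}" by blast
    then have "card ?Z \<le> card {i, x}" by (intro card_mono) simp_all
    also have "\<dots> \<le> 2" by (simp add: card_insert_if)
    finally show ?thesis .
  qed
  moreover have "card ({1..n} - ?Z) \<le> (\<Sum>i\<in>{1..n}. a i)"
  proof -
    have "card ({1..n} - ?Z) = (\<Sum>i\<in>{1..n} - ?Z. 1)" by simp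
    also have "\<dots> \<le> (\<Sum>i\<in>{1..n} - ?Z. a i)" by (intro sum_mono) auto
    also have "\<dots> \<le> (\<Sum>i\<in>{1..n}. a i)" by (intro sum_mono2) auto
    finally show ?thesis .
  qed
  moreover have "card ({1..n} - ?Z) = n - card ?Z" by (subst card_Diff_subset) auto
  ultimately show ?thesis by linarith
qed

lemma sum_ge_if_nonempty:
  assumes "S \<noteq> {}"
  shows "n \<le> (\<Sum>i\<in>{1..n}. a i) + card S"
proof -
  have "n - card S = card ({1..n} - S)" 
    using card_Diff_subset[OF finite_subset[OF S finite_atLeastAtMost] S] by simp
  also have "\<dots> = (\<Sum>i\<in>{1..n} - S. 1)" by simp
  also have "\<dots> \<le> (\<Sum>i\<in>{1..n} - S. a i)" using pos_outside[OF assms] by (intro sum_mono) (auto simp: Suc_le_eq)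
  also have "\<dots> \<le> (\<Sum>i\<in>{1..n}. a i)" by (intro sum_mono2) auto
  finally show ?thesis by linarith
qed

text \<open>Each monomial of \<open>fa\<close> contains exactly one of \<open>X c\<close>,
  \<open>Y c\<close>, to the first power. The former terms give \<open>G\<close>, the latter
  \<open>H\<close>; nothing else depends on the label of \<open>c\<close>.\<close>

lemma phi_fa_linear:
  assumes c: "c \<in> {1..n}" "a c = 1"
  shows "\<exists>G H. \<forall>l. phi n {} (h(c := l)) fa = G + single (single (2 * l + 1) 1) 1 * H"
proof -
  define th where "th m = (\<Sum>i\<in>{1..n}. single (2 * i) (mdeg m i)) +
    (\<Sum>i\<in>{1..n} - {c}. single (2 * h i + 1) (lookup m (Y i)))" for m
  have th: "theta n (h(c := l)) m = th m + single (2 * l + 1) (lookup m (Y c))" for m l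
  proof -
    have "(\<Sum>i\<in>{1..n}. single (2 * (h(c := l)) i + 1) (lookup m (Y i))) =
        single (2 * l + 1) (lookup m (Y c)) + (\<Sum>i\<in>{1..n} - {c}. single (2 * h i + 1) (lookup m (Y i)))"
      using c(1) by (subst sum.remove[of _ c]) (auto intro!: sum.cong)
    then show ?thesis
      unfolding theta_def th_def sum.distrib by (simp add: ac_simps)
  qed
  define G where "G = (\<Sum>m\<in>{m \<in> keys fa. lookup m (Y c) = 0}. single (th m) (lookup fa m))"
  define H where "H = (\<Sum>m\<in>{m \<in> keys fa. lookup m (Y c) \<noteq> 0}. single (th m) (lookup fa m))"
  have "phi n {} (h(c := l)) fa = G + single (single (2 * l + 1) 1) 1 * H" for l
  proof -
    have Yc: "lookup m (Y c) = 1" if "m \<in> keys fa" "lookup m (Y c) \<noteq> 0" for m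
      using mdeg_fa[OF that(1) c(1)] that(2) c(2) by (simp add: mdeg_def)
    have "phi n {} (h(c := l)) fa = (\<Sum>m\<in>keys fa. single (theta n (h(c := l)) m) (lookup fa m))"
      by (simp add: phi_def avoids_def)
    also have "\<dots> = (\<Sum>m\<in>{m \<in> keys fa. lookup m (Y c) = 0}. single (theta n (h(c := l)) m) (lookup fa m)) +
       (\<Sum>m\<in>{m \<in> keys fa. lookup m (Y c) \<noteq> 0}. single (theta n (h(c := l)) m) (lookup fa m))"
      by (subst sum.union_disjoint[symmetric]) (auto intro!: sum.cong)
    also have "(\<Sum>m\<in>{m \<in> keys fa. lookup m (Y c) = 0}. single (theta n (h(c := l)) m) (lookup fa m)) = G"
      unfolding G_def by (intro sum.cong) (auto simp: th)
    also have "(\<Sum>m\<in>{m \<in> keys fa. lookup m (Y c) \<noteq> 0}. single (theta n (h(c := l)) m) (lookup fa m)) =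
        single (single (2 * l + 1) 1) 1 * H"
      unfolding H_def sum_distrib_left
      by (intro sum.cong) (use Yc in \<open>auto simp: th mult_single add.commute\<close>)
    finally show ?thesis .
  qed
  then show ?thesis by blast
qed

text \<open>
  Adding \<open>s\<close> or \<open>s + 2\<close> to the graph merges the arc \<open>{c}\<close>, \<open>c = s + 1\<close>, with its left or right neighbouring
  arc. So the image of \<open>f\<close> vanishes under both specialisations of \<open>b\<^sub>c\<close>, which is impossible if it
  is linear in \<open>b\<^sub>c\<close>; the two arcs are different because \<open>|S| \<ge> 3\<close>.
\<close>

lemma singleton_arc_ge_2:
  assumes s: "s \<in> S" "cyc_succ n (cyc_succ n s) \<in> S" and card: "card S \<ge> 3"
  shows "a (cyc_succ n s) \<ge> 2"
proof (rule ccontr)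
  let ?c = "cyc_succ n s"
  let ?t = "cyc_succ n ?c"
  let ?l = "arc_label n S"
  assume "\<not> a ?c \<ge> 2"
  then have ac: "a ?c = 1" using neighbour_pos(1)[OF s(1)] by linarith
  have R: "s \<in> {1..n}" "?c \<in> {1..n}" "?t \<in> {1..n}" using S s cyc_succ_range by blast+
  have ps: "cyc_pred n s \<notin> S" "?c \<notin> S" "cyc_succ n ?t \<notin> S" "cyc_pred n s \<in> {1..n}" "cyc_succ n ?t \<in> {1..n}"
    using neighbour_notin s cyc_pred_range[OF R(1)] cyc_succ_range[OF R(3)] by blast+
  note neq = cyc_neq(1)[OF n R(1), THEN not_sym] cyc_neq(1)[OF n R(2)] cyc_neq(4)[OF n R(1), THEN not_sym]
    cyc_neq(2)[OF n R(1)] cyc_neq(3)[OF n R(1), THEN not_sym] cyc_neq(1)[OF n R(3)] cyc_neq(4)[OF n R(2)]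
  \<comment> \<open>\<open>r\<close> is one of the two vertices of \<open>S\<close> next to
    \<open>?c\<close>, \<open>r'\<close> the other one, and \<open>v\<close> the vertex beyond
    \<open>r\<close>. Putting \<open>r\<close> back joins \<open>?c\<close> to the arc of
    \<open>v\<close>.\<close>
  have zero: "phi n {} (?l(?c := ?l v)) fa = 0"
    if r: "r \<in> S" and v: "v \<notin> S" "v \<noteq> ?c"
      and nb: "{cyc_succ n r, cyc_pred n r} = {?c, v}" and r': "{cyc_succ n ?c, cyc_pred n ?c} = {r, r'}" "r' \<in> S" "r' \<noteq> r" for r r' v
  proof -
    define h where "h = ?l(?c := ?l v, r := ?l v)"
    have rc: "r \<noteq> ?c" using r ps by auto
    have vr: "v \<noteq> r" using r v by auto
    have "const_on_edges (cycle_edges n) (S - {r}) h"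
    proof (rule const_on_edges_cycle)
      fix i assume i: "i \<in> {1..n}" "i \<notin> S - {r}" "cyc_succ n i \<notin> S - {r}"
      consider "i = r" | "cyc_succ n i = r" | "i \<noteq> r" "cyc_succ n i \<noteq> r" by blast
      then show "h i = h (cyc_succ n i)"
      proof cases
        case 1
        then have "cyc_succ n i \<in> {?c, v}" using nb by auto
        then show ?thesis using 1 rc vr v by (auto simp: h_def)
      next
        case 2
        then have "i \<in> {?c, v}" using nb cyc_pred_succ[OF i(1)] by auto
        then show ?thesis using 2 rc vr v by (auto simp: h_def)
      next
        case 3
        have "i \<noteq> ?c"
        proof
          assume "i = ?c"
          then have "cyc_succ n i \<in> {r, r'}" using r'(1) by blast
          then show False using 3(2) i(3) r'(2,3) by blast
        qed
        moreover have "cyc_succ n i \<noteq> ?c"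
        proof
          assume "cyc_succ n i = ?c"
          then have "i = cyc_pred n ?c" using cyc_pred_succ[OF i(1)] by metis
          then have "i \<in> {r, r'}" using r'(1) by blast
          then show False using 3(1) i(2) r'(2,3) by blast
        qed
        moreover have "?l i = ?l (cyc_succ n i)" using 3 i(2,3) by (intro arc_label_succ[OF i(1)]) blast+
        ultimately show ?thesis using 3 by (simp add: h_def)
      qed
    qed
    then have phi0: "phi n (S - {r}) h fa = 0" using r by (rule phi_fa_eq_0) simp
    have "a r = 0" using a_eq_0 r by blast
    \<comment> \<open>All vertices of \<open>S\<close> have degree 0, so they need not be killed and
      the label of \<open>r\<close> drops out.\<close>
    show ?thesis
    proof (rule phi_fa_mono[OF phi0])
      fix u w assume uw: "a u > 0" "a w > 0" "h u = h w"
      then have "u \<noteq> r" "w \<noteq> r" using \<open>a r = 0\<close> by (metis less_irrefl)+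
      then show "(?l(?c := ?l v)) u = (?l(?c := ?l v)) w"
        using uw(3) by (simp add: h_def)
    next
      fix i assume "i \<in> S - {r}"
      then show "a i = 0" using a_eq_0 by blast
    qed (use S in auto)
  qed
  have z1: "phi n {} (?l(?c := ?l (cyc_pred n s))) fa = 0"
  proof (rule zero[OF s(1) ps(1) _ _ _ s(2)])
    show "{cyc_succ n ?c, cyc_pred n ?c} = {s, ?t}" by (simp only: cyc_pred_succ[OF R(1)] insert_commute)
  qed (use neq in simp_all)
  have z2: "phi n {} (?l(?c := ?l (cyc_succ n ?t))) fa = 0"
  proof (rule zero[OF s(2) ps(3) _ _ _ s(1)])
    show "{cyc_succ n ?t, cyc_pred n ?t} = {?c, cyc_succ n ?t}" by (simp only: cyc_pred_succ[OF R(2)] insert_commute)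
    show "{cyc_succ n ?c, cyc_pred n ?c} = {?t, s}" by (simp only: cyc_pred_succ[OF R(1)] insert_commute)
  qed (use neq in simp_all)
  \<comment> \<open>If the outer arcs coincided, putting back \<open>s\<close> alone would join both
    sides of \<open>?t\<close>; but \<open>?t\<close> and a third vertex \<open>r\<close> of
    \<open>S\<close> still separate them.\<close>
  have labels: "?l (cyc_pred n s) \<noteq> ?l (cyc_succ n ?t)"
  proof
    assume eq: "?l (cyc_pred n s) = ?l (cyc_succ n ?t)"
    let ?T = "S - {s}"
    have "card (S - {s, ?t}) \<ge> 1"
      using card s neq by (subst card_Diff_subset) auto
    then obtain r where r: "r \<in> S" "r \<noteq> s" "r \<noteq> ?t" 
      by (metis DiffD1 DiffD2 all_not_in_conv card.empty insertCI not_one_le_zero)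
    have "arc_label n ?T (cyc_pred n s) = arc_label n ?T (cyc_succ n ?t)"
    proof (rule const_on_edgesD[OF _ eq])
      show "const_on_edges (cycle_edges n) S (arc_label n ?T)"
        using arc_label_succ[of _ n ?T] by (intro const_on_edges_cycle) auto
    qed
    moreover have "arc_label n ?T (cyc_pred n s) = arc_label n ?T s" "arc_label n ?T s = arc_label n ?T ?c"
      using arc_label_pred[OF R(1), of ?T] arc_label_succ[OF R(1), of ?T] ps by auto
    ultimately have "arc_label n ?T (cyc_pred n ?t) = arc_label n ?T (cyc_succ n ?t)"
      using cyc_pred_succ[OF R(2)] by simp
    moreover have "arc_label n ?T (cyc_pred n ?t) \<noteq> arc_label n ?T (cyc_succ n ?t)"
    proof (rule arc_label_separated[OF _ _ _ R(3), of _ r])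
      show "?t \<in> ?T" using s(2) neq(3) by (metis DiffI singletonD)
      show "r \<in> ?T" "r \<in> {1..n}" using r S by blast+
      show "cyc_pred n ?t \<notin> ?T" "cyc_succ n ?t \<notin> ?T" using ps(2,3) cyc_pred_succ[OF R(2)] by simp_all
    qed (use r in blast)
    ultimately show False by simp
  qed
  obtain G H where GH: "\<And>l. phi n {} (?l(?c := l)) fa = G + single (single (2 * l + 1) 1) 1 * H"
    using phi_fa_linear[OF R(2) ac] by blast
  let ?b = "\<lambda>l. single (single (2 * l + 1) 1) 1 :: target"
  have inj: "?b l = ?b l' \<Longrightarrow> l = l'" for l l'
  proof -
    assume "?b l = ?b l'"
    then have "single (2 * l + 1) (1::nat) = single (2 * l' + 1) 1"
      by (metis keys_single the_elem_eq zero_neq_one)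
    then have "2 * l + 1 = 2 * l' + 1" by (metis keys_single the_elem_eq zero_neq_one)
    then show ?thesis by simp
  qed
  have "(?b (?l (cyc_pred n s)) - ?b (?l (cyc_succ n ?t))) * H =
      (G + ?b (?l (cyc_pred n s)) * H) - (G + ?b (?l (cyc_succ n ?t)) * H)"
    by (simp add: left_diff_distrib)
  also have "\<dots> = 0" using z1 z2 unfolding GH by simp
  finally have "H = 0" using labels inj by auto
  then have "G = 0" using z1 unfolding GH by simp
  have "phi n {} (?l(?c := ?l ?c)) fa = 0" unfolding GH by (simp add: \<open>G = 0\<close> \<open>H = 0\<close>)
  then have "phi n {} ?l fa = 0" by (simp only: fun_upd_triv)
  then have "phi n S ?l fa = 0" by (rule phi_fa_mono) (use S in auto)
  then show False using fa_nonzero by simp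
qed

text \<open>Each \<open>s\<close> is charged with the vertices outside \<open>S\<close> among the
  next two: one vertex of degree at least 2 if its arc is a singleton, otherwise two of positive
  degree. Since no two vertices of \<open>S\<close> are adjacent, the charges are disjoint.\<close>

lemma sum_ge_twice_card:
  assumes "card S \<ge> 3"
  shows "2 * card S \<le> (\<Sum>i\<in>{1..n}. a i)"
proof -
  define B where "B s = {cyc_succ n s, cyc_succ n (cyc_succ n s)} - S" for s
  have fin: "finite S" using S finite_subset by blast
  have ne: "S \<noteq> {}" using assms by auto
  have range: "B s \<subseteq> {1..n}" if "s \<in> S" for s
    using that S cyc_succ_range unfolding B_def by blast
  have disj: "B s \<inter> B r = {}" if "s \<in> S" "r \<in> S" "s \<noteq> r" for s r
  proof -
    have R: "s \<in> {1..n}" "r \<in> {1..n}" using that S by auto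
    have inj: "x = y" if "cyc_succ n x = cyc_succ n y" "x \<in> {1..n}" "y \<in> {1..n}" for x y
      using that cyc_pred_succ by metis
    have "cyc_succ n s \<noteq> cyc_succ n (cyc_succ n r)" "cyc_succ n r \<noteq> cyc_succ n (cyc_succ n s)"
      using inj[of s "cyc_succ n r"] inj[of r "cyc_succ n s"] neighbour_notin that R cyc_succ_range by metis+
    moreover have "cyc_succ n s \<noteq> cyc_succ n r" using inj R that by blast
    moreover have "cyc_succ n (cyc_succ n s) \<noteq> cyc_succ n (cyc_succ n r)"
      using inj[OF _ cyc_succ_range[OF R(1)] cyc_succ_range[OF R(2)]] \<open>cyc_succ n s \<noteq> cyc_succ n r\<close> by blast
    ultimately show ?thesis by (auto simp: B_def)
  qed
  have "2 * card S = (\<Sum>s\<in>S. 2)" by simp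
  also have "\<dots> \<le> (\<Sum>s\<in>S. \<Sum>i\<in>B s. a i)"
  proof (rule sum_mono)
    fix s assume s: "s \<in> S"
    have R: "s \<in> {1..n}" "cyc_succ n s \<in> {1..n}" "cyc_succ n (cyc_succ n s) \<in> {1..n}"
      using s S cyc_succ_range by blast+
    have c: "cyc_succ n s \<notin> S" using neighbour_notin[OF s] by simp
    show "2 \<le> (\<Sum>i\<in>B s. a i)"
    proof (cases "cyc_succ n (cyc_succ n s) \<in> S")
      case True
      then have "B s = {cyc_succ n s}" using c by (auto simp: B_def)
      then show ?thesis using singleton_arc_ge_2[OF s True assms] by simp
    next
      case False
      then have "B s = {cyc_succ n s, cyc_succ n (cyc_succ n s)}" using c by (auto simp: B_def)
      moreover have "cyc_succ n s \<noteq> cyc_succ n (cyc_succ n s)" using cyc_neq(1)[OF n R(2)] by (rule not_sym)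
      moreover have "a (cyc_succ n s) > 0" "a (cyc_succ n (cyc_succ n s)) > 0"
        using pos_outside[OF ne] R c False by blast+
      ultimately show ?thesis by simp
    qed
  qed
  also have "\<dots> = (\<Sum>i\<in>(\<Union>s\<in>S. B s). a i)"
    using disj fin by (intro sum.UNION_disjoint[symmetric]) (auto simp: B_def)
  also have "\<dots> \<le> (\<Sum>i\<in>{1..n}. a i)" using range by (intro sum_mono2) auto
  finally show ?thesis .
qed

text \<open>For \<open>card S \<ge> 3\<close>, double the bound coming from positive degrees outside
  \<open>S\<close> and estimate twice \<open>card S\<close> by the other bound. For smaller
  \<open>S\<close> at most two vertices have degree 0.\<close>

lemma sum_lower_bound: "n \<le> (\<Sum>i\<in>{1..n}. a i) + 2 \<or> 2 * n \<le> 3 * (\<Sum>i\<in>{1..n}. a i)"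
proof -
  consider "S = {}" | "S \<noteq> {}" "card S \<le> 2" | "S \<noteq> {}" "card S \<ge> 3" by linarith
  then show ?thesis
  proof cases
    case 1 then show ?thesis using sum_ge_if_empty by simp
  next
    case 2 then show ?thesis using sum_ge_if_nonempty by simp
  next
    case 3 then show ?thesis using sum_ge_if_nonempty sum_ge_twice_card by simp
  qed
qed

end

lemma cycle_colon_degree_bound:
  assumes n: "n \<ge> 4" and f: "f \<in> carrier (poly_ring n)" "homogeneous d f"
    and P: "primeideal (colon (poly_ring n) (binomial_edge_ideal n (cycle_edges n)) f) (poly_ring n)"
  shows "n \<le> d + 2 \<or> 2 * n \<le> 3 * d"
proof -
  obtain S where S: "S \<subseteq> {1..n}" "phi n S (arc_label n S) f \<noteq> 0"
    "\<forall>g\<in>ker_ideal n S (arc_label n S). g * f \<in> binomial_edge_ideal n (cycle_edges n)"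
    by (rule prime_colon_component[OF Union_cycle_edges f(1) P])
  obtain w where w: "lookup (phi n S (arc_label n S) f) w \<noteq> 0"
    using S(2) by (metis poly_mapping_eqI lookup_zero)
  let ?B = "{m \<in> keys f. avoids S m \<and> theta n (arc_label n S) m = w}"
  have "?B \<noteq> {}" using w unfolding lookup_phi by (metis sum.empty)
  then obtain m0 where m0: "m0 \<in> ?B" by blast
  \<comment> \<open>All monomials of this fibre share the multidegree of \<open>m0\<close>, so that
    component of \<open>f\<close> keeps the non-zero coefficient at \<open>w\<close>.\<close>
  define a where "a = mdeg m0"
  let ?Q = "\<lambda>m. \<forall>i\<in>{1..n}. mdeg m i = a i"
  have Q: "?Q m" if "m \<in> ?B" for m
    using that m0 mdeg_eq_of_theta_eq[of n "arc_label n S" m "arc_label n S" m0] by (auto simp: a_def)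
  have "{m \<in> keys (restr ?Q f). avoids S m \<and> theta n (arc_label n S) m = w} = ?B"
    unfolding keys_restr using Q by blast
  then have "lookup (phi n S (arc_label n S) (restr ?Q f)) w = (\<Sum>m\<in>?B. lookup (restr ?Q f) m)"
    by (simp only: lookup_phi)
  also have "\<dots> = (\<Sum>m\<in>?B. lookup f m)"
  proof (intro sum.cong refl)
    fix m assume "m \<in> ?B"
    from Q[OF this] show "lookup (restr ?Q f) m = lookup f m" unfolding lookup_restr by (rule if_P)
  qed
  also have "\<dots> \<noteq> 0" using w unfolding lookup_phi .
  finally have "phi n S (arc_label n S) (restr ?Q f) \<noteq> 0" by (metis lookup_zero)
  then have "n \<le> (\<Sum>i\<in>{1..n}. a i) + 2 \<or> 2 * n \<le> 3 * (\<Sum>i\<in>{1..n}. a i)"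
    using S(1,3) n f(1) by (intro sum_lower_bound[of n S f]) auto
  moreover have "d = (\<Sum>i\<in>{1..n}. a i)"
    using m0 f mon_degree_eq_sum_mdeg[of m0 n] by (auto simp: homogeneous_def carrier_iff a_def)
  ultimately show ?thesis by simp
qed

subsection \<open>The upper bound\<close>

lemma homogeneous_indet: "homogeneous 1 (indet v)"
  by (simp add: homogeneous_def indet_def mon_degree_def)

lemma mon_degree_add: "mon_degree (m + m') = mon_degree m + mon_degree m'"
proof -
  have sum_eq: "mon_degree q = (\<Sum>v\<in>keys m \<union> keys m'. lookup q v)" if "keys q \<subseteq> keys m \<union> keys m'" for q
    unfolding mon_degree_def using that by (intro sum.mono_neutral_left) (auto simp: in_keys_iff)
  show ?thesis
    by (simp add: sum_eq keys_add_mono lookup_add sum.distrib)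
qed

lemma homogeneous_mult:
  assumes "homogeneous d f" "homogeneous e g"
  shows "homogeneous (d + e) (f * g)"
  unfolding homogeneous_def
proof
  fix m assume "m \<in> keys (f * g)"
  then obtain p q where "m = p + q" "p \<in> keys f" "q \<in> keys g"
    using Poly_Mapping.keys_mult[of f g] by auto
  then show "mon_degree m = d + e" using assms by (simp add: homogeneous_def mon_degree_add)
qed

lemma homogeneous_diff: "homogeneous d f \<Longrightarrow> homogeneous d g \<Longrightarrow> homogeneous d (f - g)"
  using Poly_Mapping.keys_diff[of f g] by (auto simp: homogeneous_def)

lemma homogeneous_minor: "homogeneous 2 (minor u v)"
proof -
  have "homogeneous 2 (indet x * indet y)" for x y
    using homogeneous_mult[OF homogeneous_indet[of x] homogeneous_indet[of y]] by (simp only: one_add_one)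
  then show ?thesis unfolding minor_def by (intro homogeneous_diff)
qed

lemma homogeneous_prod:
  "finite A \<Longrightarrow> (\<And>a. a \<in> A \<Longrightarrow> homogeneous e (F a)) \<Longrightarrow> homogeneous (e * card A) (prod F A)"
proof (induction A rule: finite_induct)
  case empty
  show ?case by (simp add: homogeneous_def mon_degree_def)
next
  case (insert a A)
  then show ?case using homogeneous_mult[of e "F a" "e * card A" "prod F A"] by simp
qed

lemma phi_indet_X_nonzero: "i \<in> {1..n} \<Longrightarrow> i \<notin> T \<Longrightarrow> phi n T h (indet (X i)) \<noteq> 0"
  using phi_X[of i n T h] by (metis keys_single keys_eq_empty insert_not_empty zero_neq_one)

text \<open>The kernel for \<open>S\<close> is prime and omits \<open>f\<close>, which bounds the
  colon ideal from above. Conversely, every kernel either contains \<open>f\<close> or, belonging to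
  a larger set that separates no further surviving vertices, contains the kernel for
  \<open>S\<close>.\<close>

lemma colon_eq_ker_ideal:
  assumes E: "\<Union>E \<subseteq> {1..n}" and f: "f \<in> carrier (poly_ring n)"
    and S: "S \<subseteq> {1..n}" "phi n S (comp_label E S) f \<noteq> 0"
    and T: "\<And>T. \<lbrakk>T \<subseteq> {1..n}; phi n T (comp_label E T) f \<noteq> 0\<rbrakk> \<Longrightarrow> S \<subseteq> T \<and>
      (\<forall>u\<in>{1..n} - T. \<forall>v\<in>{1..n} - T. comp_label E S u = comp_label E S v \<longrightarrow> comp_label E T u = comp_label E T v)"
  shows "colon (poly_ring n) (binomial_edge_ideal n E) f = ker_ideal n S (comp_label E S)"
proof
  let ?J = "binomial_edge_ideal n E"
  have J: "?J = (\<Inter>T\<in>Pow {1..n}. ker_ideal n T (comp_label E T))"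
    by (rule binomial_edge_ideal_eq_Inter[OF E])
  show "colon (poly_ring n) ?J f \<subseteq> ker_ideal n S (comp_label E S)"
  proof
    fix g assume "g \<in> colon (poly_ring n) ?J f"
    then have g: "g \<in> carrier (poly_ring n)" "g * f \<in> ?J" by (auto simp: colon_def)
    then have "g * f \<in> ker_ideal n S (comp_label E S)" using S(1) unfolding J by blast
    then show "g \<in> ker_ideal n S (comp_label E S)"
      using g(1) S(2) by (simp add: ker_ideal_def phi_mult)
  qed
  show "ker_ideal n S (comp_label E S) \<subseteq> colon (poly_ring n) ?J f"
  proof
    fix g assume "g \<in> ker_ideal n S (comp_label E S)"
    then have g: "g \<in> carrier (poly_ring n)" "phi n S (comp_label E S) g = 0" by (auto simp: ker_ideal_def)
    have "g * f \<in> ker_ideal n U (comp_label E U)" if U: "U \<subseteq> {1..n}" for U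
    proof (cases "phi n U (comp_label E U) f = 0")
      case True
      then show ?thesis using g f by (simp add: ker_ideal_def phi_mult carrier_mult)
    next
      case False
      from T[OF U False] have SU: "S \<subseteq> U" and lab: "\<And>u v. \<lbrakk>u \<in> {1..n} - U; v \<in> {1..n} - U;
          comp_label E S u = comp_label E S v\<rbrakk> \<Longrightarrow> comp_label E U u = comp_label E U v" by blast+
      have "phi n U (comp_label E U) g = 0"
      proof (rule phi_eq_0_mono[OF g(2)])
        fix m assume "avoids U m"
        then show "avoids S m" using SU by (auto simp: avoids_def)
      next
        fix m m' assume m: "avoids U m"
          "theta n (comp_label E S) m = theta n (comp_label E S) m'"
        have "avoids U m'"
          unfolding avoids_def
        proof
          fix i assume i: "i \<in> U"
          then have "mdeg m i = 0" using m(1) by (simp add: avoids_def)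
          then show "mdeg m' i = 0" using mdeg_eq_of_theta_eq[OF m(2), of i] i U by auto
        qed
        moreover have "theta n (comp_label E U) m = theta n (comp_label E U) m'"
        proof (rule theta_mono[OF m(2)])
          fix u v assume uv: "u \<in> {1..n}" "v \<in> {1..n}" "mdeg m u > 0" "mdeg m v > 0"
            "comp_label E S u = comp_label E S v"
          then have "u \<notin> U" "v \<notin> U" using m(1) by (auto simp: avoids_def)
          then show "comp_label E U u = comp_label E U v" using lab[of u v] uv by blast
        qed
        ultimately show "avoids U m' \<and> theta n (comp_label E U) m = theta n (comp_label E U) m'" ..
      qed
      then show ?thesis using g f by (simp add: ker_ideal_def phi_mult carrier_mult)
    qed
    then have "g * f \<in> ?J" unfolding J by blast
    then show "g \<in> colon (poly_ring n) ?J f" using g by (simp add: colon_def)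
  qed
qed

definition v_degree :: "nat \<Rightarrow> mpoly set \<Rightarrow> nat \<Rightarrow> bool" where
  "v_degree n I d \<longleftrightarrow> (\<exists>f\<in>carrier (poly_ring n). homogeneous d f \<and>
       (\<exists>P\<in>Ass (poly_ring n) I. colon (poly_ring n) I f = P))"

lemma v_degreeI:
  assumes "f \<in> carrier (poly_ring n)" "homogeneous d f"
    and "colon (poly_ring n) I f = ker_ideal n S h"
  shows "v_degree n I d"
  unfolding v_degree_def Ass_def
proof (intro bexI[OF _ assms(1)] conjI assms(2) bexI)
  show "colon (poly_ring n) I f = ker_ideal n S h" by (rule assms(3))
  show "ker_ideal n S h \<in> {P. primeideal P (poly_ring n) \<and> (\<exists>f\<in>carrier (poly_ring n). P = colon (poly_ring n) I f)}"
    using primeideal_ker_ideal assms(1,3) by blast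
qed

text \<open>A set \<open>T\<close> that does not kill the product of the \<open>X i\<close> with
  \<open>i \<ge> 3\<close> is contained in {1, 2}, and the remaining vertices then lie on one
  path.\<close>

lemma v_degree_connected:
  assumes "n \<ge> 4"
  shows "v_degree n (binomial_edge_ideal n (cycle_edges n)) (n - 2)"
proof (rule v_degreeI)
  let ?f = "\<Prod>i\<in>{3..n}. indet (X i)"
  show f: "?f \<in> carrier (poly_ring n)" by (intro carrier_prod carrier_X) auto
  have "homogeneous (1 * card {3..n}) ?f" by (intro homogeneous_prod homogeneous_indet) auto
  moreover have "1 * card {3..n} = n - 2" by simp
  ultimately show "homogeneous (n - 2) ?f" by metis
  show "colon (poly_ring n) (binomial_edge_ideal n (cycle_edges n)) ?f = ker_ideal n {} (arc_label n {})"
  proof (rule colon_eq_ker_ideal[OF Union_cycle_edges f])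
    show "phi n {} (arc_label n {}) ?f \<noteq> 0"
      unfolding phi_prod using phi_indet_X_nonzero[of _ n "{}"] by (auto simp: prod_zero_iff)
  next
    fix T assume T: "T \<subseteq> {1..n}" "phi n T (arc_label n T) ?f \<noteq> 0"
    have nT: "i \<notin> T" if "i \<in> {3..n}" for i
    proof
      assume "i \<in> T"
      then have "phi n T (arc_label n T) (indet (X i)) = 0" using phi_X[of i n T] T(1) by auto
      then show False using T(2) that unfolding phi_prod by (auto simp: prod_zero_iff)
    qed
    have big: "arc_label n T i = arc_label n T 3" if "i \<ge> 3" "i \<le> n" for i
      using that
    proof (induction i rule: dec_induct)
      case (step i)
      then show ?case
        using arc_label_succ[of i n T] nT[of i] nT[of "Suc i"] by (simp add: cyc_succ_def)
    qed simp
    have "arc_label n T i = arc_label n T 3" if i: "i \<in> {1..n} - T" for i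
    proof -
      consider "i \<ge> 3" | "i = 2" | "i = 1" using i by fastforce
      then show ?thesis
      proof cases
        case 1 then show ?thesis using big[of i] i by simp
      next
        case 2
        have "cyc_succ n 2 = 3" using assms by (simp add: cyc_succ_def)
        then show ?thesis using 2 arc_label_succ[of 2 n T] nT[of 3] i assms by auto
      next
        case 3
        have "cyc_succ n n = 1" by (simp add: cyc_succ_def)
        then have "arc_label n T n = arc_label n T 1"
          using 3 arc_label_succ[of n n T] nT[of n] i assms by auto
        then show ?thesis using 3 big[of n] assms by simp
      qed
    qed
    then have "\<forall>u\<in>{1..n} - T. \<forall>v\<in>{1..n} - T. arc_label n T u = arc_label n T v" by metis
    then show "{} \<subseteq> T \<and> (\<forall>u\<in>{1..n} - T. \<forall>v\<in>{1..n} - T.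
        arc_label n {} u = arc_label n {} v \<longrightarrow> arc_label n T u = arc_label n T v)"
      by blast
  qed simp
qed

text \<open>The minor of the neighbours of \<open>s\<close> survives for \<open>T\<close> only if
  they lie in different arcs, which forces \<open>s\<close> into \<open>T\<close>; the variables
  keep \<open>T\<close> off the vertices at distance at least 2 from \<open>S\<close>. With two
  vertices in \<open>S\<close>, no minor vanishes for \<open>S\<close> itself.\<close>

lemma v_degree_cut_set:
  assumes n: "n \<ge> 4" and S: "S \<subseteq> {1..n}" "card S \<ge> 2" "\<And>s. s \<in> S \<Longrightarrow> cyc_succ n s \<notin> S"
  shows "v_degree n (binomial_edge_ideal n (cycle_edges n))
    (2 * card S + card {i \<in> {1..n}. cyc_pred n i \<notin> S \<and> i \<notin> S \<and> cyc_succ n i \<notin> S})"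
proof (rule v_degreeI)
  let ?M = "{i \<in> {1..n}. cyc_pred n i \<notin> S \<and> i \<notin> S \<and> cyc_succ n i \<notin> S}"
  let ?F = "\<Prod>s\<in>S. minor (cyc_pred n s) (cyc_succ n s)"
  let ?G = "\<Prod>i\<in>?M. indet (X i)"
  let ?f = "?F * ?G"
  have fin: "finite S" using S(1) finite_subset by blast
  have pred: "cyc_pred n s \<notin> S" if "s \<in> S" for s
  proof
    assume "cyc_pred n s \<in> S"
    then have "cyc_succ n (cyc_pred n s) \<notin> S" by (rule S(3))
    then show False using that S(1) cyc_succ_pred by auto
  qed
  show f: "?f \<in> carrier (poly_ring n)"
    using S(1) by (intro carrier_mult carrier_prod carrier_X carrier_minor cyc_succ_range cyc_pred_range) auto
  show "homogeneous (2 * card S + card ?M) ?f"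
  proof (rule homogeneous_mult)
    show "homogeneous (2 * card S) ?F" using fin by (intro homogeneous_prod homogeneous_minor)
    have "homogeneous (1 * card ?M) ?G" by (intro homogeneous_prod homogeneous_indet) simp
    then show "homogeneous (card ?M) ?G" by (simp only: mult_1)
  qed
  show "colon (poly_ring n) (binomial_edge_ideal n (cycle_edges n)) ?f = ker_ideal n S (arc_label n S)"
  proof (rule colon_eq_ker_ideal[OF Union_cycle_edges f S(1)])
    have "phi n S (arc_label n S) (minor (cyc_pred n s) (cyc_succ n s)) \<noteq> 0" if s: "s \<in> S" for s
    proof -
      have R: "s \<in> {1..n}" using s S by blast
      have "card (S - {s}) \<ge> 1" using S(2) s fin by simp
      then obtain r where r: "r \<in> S" "r \<noteq> s" by (metis DiffE card.empty ex_in_conv insertCI not_one_le_zero)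
      have "arc_label n S (cyc_pred n s) \<noteq> arc_label n S (cyc_succ n s)"
        using S(1) r by (intro arc_label_separated[OF s r(1) _ R _ pred[OF s] S(3)[OF s]]) auto
      then show ?thesis
        using phi_minor_eq_0[OF cyc_pred_range[OF R] cyc_succ_range[OF R]] pred[OF s] S(3)[OF s] by blast
    qed
    then have "phi n S (arc_label n S) ?F \<noteq> 0" unfolding phi_prod using fin by (simp add: prod_zero_iff)
    moreover have "phi n S (arc_label n S) ?G \<noteq> 0"
      unfolding phi_prod using phi_indet_X_nonzero[of _ n S] by (auto simp: prod_zero_iff)
    ultimately show "phi n S (arc_label n S) ?f \<noteq> 0" by (simp add: phi_mult)
  next
    fix T assume T: "T \<subseteq> {1..n}" "phi n T (arc_label n T) ?f \<noteq> 0"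
    then have F: "phi n T (arc_label n T) ?F \<noteq> 0" and G: "phi n T (arc_label n T) ?G \<noteq> 0"
      by (simp_all add: phi_mult)
    have ST: "S \<subseteq> T"
    proof
      fix s assume s: "s \<in> S"
      then have R: "s \<in> {1..n}" using S(1) by blast
      have "phi n T (arc_label n T) (minor (cyc_pred n s) (cyc_succ n s)) \<noteq> 0"
        using F s fin unfolding phi_prod by (auto simp: prod_zero_iff)
      then have *: "cyc_pred n s \<notin> T" "cyc_succ n s \<notin> T"
        "arc_label n T (cyc_pred n s) \<noteq> arc_label n T (cyc_succ n s)"
        using phi_minor_eq_0[OF cyc_pred_range[OF R] cyc_succ_range[OF R]] by blast+
      show "s \<in> T"
      proof (rule ccontr)
        assume "s \<notin> T"
        then show False using * arc_label_pred[OF R] arc_label_succ[OF R] by metis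
      qed
    qed
    have MT: "i \<notin> T" if "i \<in> ?M" for i
    proof
      assume "i \<in> T"
      then have "phi n T (arc_label n T) (indet (X i)) = 0" using phi_X[of i n T] T(1) by auto
      then show False using G that unfolding phi_prod by (auto simp: prod_zero_iff)
    qed
    text \<open>
      A vertex of \<open>T - S\<close> is adjacent to \<open>S\<close>, so deleting it does not disconnect its
      component: give it the label of its other neighbour.
    \<close>
    define h where "h i = (if i \<notin> T then arc_label n T i
      else if cyc_succ n i \<notin> T then arc_label n T (cyc_succ n i)
      else if cyc_pred n i \<notin> T then arc_label n T (cyc_pred n i) else 0)" for i
    have h: "const_on_edges (cycle_edges n) S h"
    proof (rule const_on_edges_cycle)
      fix i assume i: "i \<in> {1..n}" "i \<notin> S" "cyc_succ n i \<notin> S"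
      have j: "cyc_succ n i \<in> {1..n}" "cyc_pred n (cyc_succ n i) = i" 
        by (fact cyc_succ_range[OF i(1)], fact cyc_pred_succ[OF i(1)])
      \<comment> \<open>A vertex of \<open>T\<close> outside \<open>S\<close> has a neighbour in
        \<open>S\<close>, here the one away from the edge, so \<open>h\<close> takes the label
        across the edge; if both ends are in \<open>T\<close>, both get the default 0.\<close>
      have end1: "cyc_pred n i \<in> T" if "i \<in> T"
        using MT[of i] that i ST by blast
      have end2: "cyc_succ n (cyc_succ n i) \<in> T" if "cyc_succ n i \<in> T"
        using MT[of "cyc_succ n i"] that i j ST by auto
      show "h i = h (cyc_succ n i)"
      proof (cases "i \<in> T"; cases "cyc_succ n i \<in> T")
        assume "i \<notin> T" "cyc_succ n i \<notin> T"
        then show ?thesis using arc_label_succ[OF i(1)] by (simp add: h_def)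
      qed (use end1 end2 j in \<open>auto simp: h_def\<close>)
    qed
    have "arc_label n T u = arc_label n T v"
      if "u \<in> {1..n} - T" "v \<in> {1..n} - T" "arc_label n S u = arc_label n S v" for u v
      using const_on_edgesD[OF h that(3)] that(1,2) by (simp add: h_def)
    then show "S \<subseteq> T \<and> (\<forall>u\<in>{1..n} - T. \<forall>v\<in>{1..n} - T.
        arc_label n S u = arc_label n S v \<longrightarrow> arc_label n T u = arc_label n T v)"
      using ST by blast
  qed
qed

subsection \<open>The v-number\<close>

lemma v_degree_lower_bound:
  assumes "n \<ge> 4" "v_degree n (binomial_edge_ideal n (cycle_edges n)) d"
  shows "n \<le> d + 2 \<or> 2 * n \<le> 3 * d"
proof -
  obtain f where "f \<in> carrier (poly_ring n)" "homogeneous d f"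
    "primeideal (colon (poly_ring n) (binomial_edge_ideal n (cycle_edges n)) f) (poly_ring n)"
    using assms(2) by (auto simp: v_degree_def Ass_def)
  then show ?thesis using cycle_colon_degree_bound[OF assms(1)] by blast
qed

text \<open>\<open>S\<close> consists of the multiples of 3, and of \<open>n\<close> as well if
  \<open>n mod 3 = 2\<close>; with \<open>k = n div 3\<close> the degree is at most 2k, 2k + 1, 2k +
  2 for remainder 0, 1, 2. For \<open>n = 4\<close> this set would be a singleton, and the product
  of degree \<open>n - 2\<close> is used instead.\<close>

lemma v_degree_upper_bound:
  assumes "n \<ge> 4"
  shows "\<exists>d. v_degree n (binomial_edge_ideal n (cycle_edges n)) d \<and> 3 * d \<le> 2 * n + 2"
proof (cases "n = 4")
  case True
  then show ?thesis using v_degree_connected[OF assms] by (intro exI[of _ "n - 2"]) simp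
next
  case False
  define k where "k = n div 3"
  define S where "S = (*) 3 ` {1..k} \<union> (if n mod 3 = 2 then {n} else {})"
  have nk: "n = 3 * k + n mod 3" by (simp add: k_def)
  have memS: "s \<in> S \<longleftrightarrow> s \<in> {1..n} \<and> (s mod 3 = 0 \<or> s = n \<and> n mod 3 = 2)" for s
  proof
    assume "s \<in> S"
    then show "s \<in> {1..n} \<and> (s mod 3 = 0 \<or> s = n \<and> n mod 3 = 2)"
      using nk assms by (auto simp: S_def split: if_splits)
  next
    assume s: "s \<in> {1..n} \<and> (s mod 3 = 0 \<or> s = n \<and> n mod 3 = 2)"
    show "s \<in> S"
    proof (cases "s mod 3 = 0")
      case True
      then have "s = 3 * (s div 3)" "s div 3 \<in> {1..k}" using s by (auto simp: k_def div_le_mono)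
      then show ?thesis unfolding S_def by blast
    next
      case False
      then show ?thesis using s by (simp add: S_def)
    qed
  qed
  have card: "card S = k + (if n mod 3 = 2 then 1 else 0)"
  proof -
    have "card ((*) 3 ` {1..k}) = k" by (subst card_image) (auto simp: inj_on_def)
    moreover have "n \<notin> (*) 3 ` {1..k}" if "n mod 3 = 2" using that by auto
    ultimately show ?thesis by (simp add: S_def)
  qed
  let ?M = "{i \<in> {1..n}. cyc_pred n i \<notin> S \<and> i \<notin> S \<and> cyc_succ n i \<notin> S}"
  \<comment> \<open>Every vertex except 1 is in \<open>S\<close> or next to it, and so is 1 unless
    its predecessor \<open>n\<close> is outside \<open>S\<close>, which means remainder 1.\<close>
  have M: "?M \<subseteq> (if n mod 3 = 1 then {1} else {})"
  proof
    fix i assume i: "i \<in> ?M"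
    then have mod: "i mod 3 \<noteq> 0" "i \<in> {1..n}" by (auto simp: memS)
    have "i \<noteq> n \<or> n mod 3 = 1" using i mod by (auto simp: memS)
    moreover have "i mod 3 \<noteq> 2"
    proof
      assume "i mod 3 = 2"
      then have "(i + 1) mod 3 = 0" "i \<noteq> n" using i by (presburger, auto simp: memS)
      then show False using i mod by (auto simp: memS cyc_succ_def)
    qed
    then have i1: "i mod 3 = 1" using mod(1) by presburger
    moreover have "i = 1"
    proof (rule ccontr)
      assume "i \<noteq> 1"
      moreover have "(i - 1) mod 3 = 0" using i1 by presburger
      ultimately show False using i mod by (auto simp: memS cyc_pred_def)
    qed
    moreover have "n mod 3 = 1"
    proof (rule ccontr)
      assume "n mod 3 \<noteq> 1"
      then have "n \<in> S" using assms by (auto simp: memS)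
      then show False using i \<open>i = 1\<close> by (auto simp: cyc_pred_def)
    qed
    ultimately show "i \<in> (if n mod 3 = 1 then {1} else {})" by simp
  qed
  have "card ?M \<le> card (if n mod 3 = 1 then {1::nat} else {})" by (rule card_mono[OF _ M]) simp
  then have cardM: "card ?M \<le> (if n mod 3 = 1 then 1 else 0)" by (simp split: if_splits)
  have "v_degree n (binomial_edge_ideal n (cycle_edges n)) (2 * card S + card ?M)"
  proof (rule v_degree_cut_set[OF assms])
    show "S \<subseteq> {1..n}" using memS by blast
    show "card S \<ge> 2" unfolding card k_def using assms False by presburger
    fix s assume "s \<in> S"
    then show "cyc_succ n s \<notin> S"
      unfolding memS cyc_succ_def using assms by (auto split: if_splits)
  qed
  moreover have "3 * (2 * (k + (if n mod 3 = 2 then 1 else 0)) + c) \<le> 2 * n + 2"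
    if "c \<le> (if n mod 3 = 1 then 1 else 0)" for c
    using that nk by (cases "n mod 3 = 1"; cases "n mod 3 = 2") simp_all
  then have "3 * (2 * card S + card ?M) \<le> 2 * n + 2"
    unfolding card using cardM by blast
  ultimately show ?thesis by blast
qed

lemma v_number_cycle_bounds:
  assumes "n \<ge> 4"
  shows "3 * v_number n (binomial_edge_ideal n (cycle_edges n)) \<le> 2 * n + 2"
    and "n \<le> v_number n (binomial_edge_ideal n (cycle_edges n)) + 2 \<or>
      2 * n \<le> 3 * v_number n (binomial_edge_ideal n (cycle_edges n))"
proof -
  let ?J = "binomial_edge_ideal n (cycle_edges n)"
  have v: "v_number n ?J = (LEAST d. v_degree n ?J d)" by (simp add: v_number_def v_degree_def)
  obtain d where d: "v_degree n ?J d" "3 * d \<le> 2 * n + 2" using v_degree_upper_bound[OF assms] by blast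
  show "3 * v_number n ?J \<le> 2 * n + 2"
    using Least_le[of "v_degree n ?J", OF d(1)] d(2) unfolding v by linarith
  show "n \<le> v_number n ?J + 2 \<or> 2 * n \<le> 3 * v_number n ?J"
    using v_degree_lower_bound[OF assms LeastI[of "v_degree n ?J", OF d(1)]] unfolding v .
qed

text \<open>The alternative \<open>n \<le> w + 2\<close> allows a value below 2n/3 only for
  \<open>n = 4\<close> and \<open>n = 5\<close>, where \<open>n - 2\<close> is the ceiling minus
  1.\<close>

lemma ceiling_two_thirds_cases:
  fixes n w :: nat
  assumes "n \<ge> 4" "3 * w \<le> 2 * n + 2" "n \<le> w + 2 \<or> 2 * n \<le> 3 * w"
  shows "(n mod 3 = 0 \<longrightarrow> real w = 2 * real n / 3) \<and>
    (n mod 3 = 1 \<or> n mod 3 = 2 \<longrightarrow>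
      int w = \<lceil>2 * real n / 3\<rceil> \<or> int w = \<lceil>2 * real n / 3\<rceil> - 1)"
proof -
  have "\<exists>k. n = 3 * k \<or> n = 3 * k + 1 \<or> n = 3 * k + 2" by presburger
  then obtain k where "n = 3 * k \<or> n = 3 * k + 1 \<or> n = 3 * k + 2" by blast
  then consider "n = 3 * k" | "n = 3 * k + 1" | "n = 3 * k + 2" by blast
  then show ?thesis
  proof cases
    case 1
    then have "w = 2 * k" using assms by auto
    then show ?thesis using 1 by simp
  next
    case 2
    have "\<lceil>2 * real n / 3\<rceil> = 2 * int k + 1" unfolding 2 by (rule ceiling_unique) auto
    moreover have "w = 2 * k \<or> w = 2 * k + 1" using 2 assms by auto
    moreover have "n mod 3 = 1" unfolding 2 by simp
    ultimately show ?thesis by auto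
  next
    case 3
    have "\<lceil>2 * real n / 3\<rceil> = 2 * int k + 2" unfolding 3 by (rule ceiling_unique) auto
    moreover have "w = 2 * k + 1 \<or> w = 2 * k + 2" using 3 assms by auto
    moreover have "n mod 3 = 2" using 3 by presburger
    ultimately show ?thesis by auto
  qed
qed

text \<open>For \<open>n = 3\<close> the ideal is generated by all 2-minors of a generic matrix and
  is prime, so its v-number is 0.\<close>

theorem theorem1:
  fixes n :: nat
  assumes "n \<ge> 4"
  shows "(n mod 3 = 0 \<longrightarrow>
            real (v_number n (binomial_edge_ideal n (cycle_edges n))) = 2 * real n / 3) \<and>
         (n mod 3 = 1 \<or> n mod 3 = 2 \<longrightarrow>
            int (v_number n (binomial_edge_ideal n (cycle_edges n))) = \<lceil>2 * real n / 3\<rceil> \<or>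
            int (v_number n (binomial_edge_ideal n (cycle_edges n))) = \<lceil>2 * real n / 3\<rceil> - 1)"
  by (rule ceiling_two_thirds_cases[OF assms v_number_cycle_bounds[OF assms]])

end
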